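(* Let $(X,f)$ be a topological dynamical system and let $g$ be any mistake function. For every $f$-invariant ergodic Borel probability measure $\mu$ on $X$, the limits $$\overline{h}_g(f,x)=\lim_{\varepsilon\to 0}\limsup_{n\to\infty}\frac{1}{n}\log R_n(g;x,\varepsilon)\quad\text{and}\quad \underline{h}_g(f,x)=\lim_{\varepsilon\to 0}\liminf_{n\to\infty}\frac{1}{n}\log R_n(g;x,\varepsilon)$$ exist for $\mu$-almost every $x\in X$ and coincide with the measure-theoretic entropy $h_\mu(f)$.
   Context: A topological dynamical system $(X,f)$ is a continuous map $f:X\to X$ on a compact metric space $(X,d)$. Mistake function: given $\varepsilon_0>0$, a function $g:\mathbb{N}\times(0,\varepsilon_0]\to\mathbb{N}$ is a mistake function if for all $\varepsilon\in(0,\varepsilon_0]$ and all $n\in\mathbb{N}$, $g(n,\varepsilon)\le g(n+1,\varepsilon)$ and $\lim_{n\to\infty} g(n,\varepsilon)/n=0$. One sets $g(n,\varepsilon)=g(n,\varepsilon_0)$ for $\varepsilon>\varepsilon_0$. For a finite set of integers $\Lambda\subset[0,N]$ let $d_\Lambda(x,y)=\max\{d(f^i x,f^i y): i\in\Lambda\}$ and $B_\Lambda(x,\varepsilon)=\{y\in X: d_\Lambda(x,y)<\varepsilon\}$. For $n\ge 1$ and $\varepsilon>0$ let $I(g;n,\varepsilon)=\{\Lambda\subset[0,n-1]\cap\mathbb{N}: \#\Lambda\ge n-g(n,\varepsilon)\}$ (here $0\in\mathbb{N}$). The mistake dynamical ball is $B_n(g;x,\varepsilon)=\bigcup_{\Lambda\in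 I(g;n,\varepsilon)}B_\Lambda(x,\varepsilon)$. First return time: $R_n(g;x,\varepsilon)=\inf\{k\ge 1: f^k(x)\in B_n(g;x,\varepsilon)\}$. *)

theory Defs
  imports "HOL-Probability.Probability"
begin

text \<open>A mistake function has domain \<open>\<nat> \<times> (0, \<epsilon>\<^sub>0]\<close>. It is encoded as a total function on
  \<^typ>\<open>nat\<close> and \<^typ>\<open>real\<close> whose values outside that domain are irrelevant: every use below
  goes through \<open>mistake_extension\<close>.\<close>

definition mistake_function :: "real \<Rightarrow> (nat \<Rightarrow> real \<Rightarrow> nat) \<Rightarrow> bool" where
  "mistake_function \<epsilon>0 g \<longleftrightarrow> 0 < \<epsilon>0 \<and>
     (\<forall>\<epsilon>\<in>{0<..\<epsilon>0}. (\<forall>n. g n \<epsilon> \<le> g (Suc n) \<epsilon>) \<and> (\<lambda>n. real (g n \<epsilon>) / real n) \<longlonglongrightarrow> 0)"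

definition mistake_extension :: "real \<Rightarrow> (nat \<Rightarrow> real \<Rightarrow> nat) \<Rightarrow> nat \<Rightarrow> real \<Rightarrow> nat" where
  "mistake_extension \<epsilon>0 g n \<epsilon> = (if \<epsilon> \<le> \<epsilon>0 then g n \<epsilon> else g n \<epsilon>0)"

text \<open>Inserting \<open>0\<close> only fixes the value for \<open>\<Lambda> = {}\<close>, where the maximum is read as \<open>0\<close>, so that
  the ball over \<open>{}\<close> is the whole space.\<close>

definition dyn_dist :: "('a::metric_space \<Rightarrow> 'a) \<Rightarrow> nat set \<Rightarrow> 'a \<Rightarrow> 'a \<Rightarrow> real" where
  "dyn_dist f \<Lambda> x y = Max (insert 0 ((\<lambda>i. dist ((f ^^ i) x) ((f ^^ i) y)) ` \<Lambda>))"

definition dyn_ball ::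
  "'a::metric_space set \<Rightarrow> ('a \<Rightarrow> 'a) \<Rightarrow> nat set \<Rightarrow> 'a \<Rightarrow> real \<Rightarrow> 'a set" where
  "dyn_ball X f \<Lambda> x \<epsilon> = {y \<in> X. dyn_dist f \<Lambda> x y < \<epsilon>}"

text \<open>Truncated subtraction is harmless here, because \<^term>\<open>card \<Lambda>\<close> is nonnegative.\<close>

definition mistake_index_sets :: "(nat \<Rightarrow> real \<Rightarrow> nat) \<Rightarrow> nat \<Rightarrow> real \<Rightarrow> nat set set" where
  "mistake_index_sets g n \<epsilon> = {\<Lambda>. \<Lambda> \<subseteq> {0..<n} \<and> card \<Lambda> \<ge> n - g n \<epsilon>}"

definition mistake_ball ::
  "'a::metric_space set \<Rightarrow> ('a \<Rightarrow> 'a) \<Rightarrow> (nat \<Rightarrow> real \<Rightarrow> nat) \<Rightarrow> nat \<Rightarrow> 'a \<Rightarrow> real \<Rightarrow> 'a set" where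
  "mistake_ball X f g n x \<epsilon> = (\<Union>\<Lambda>\<in>mistake_index_sets g n \<epsilon>. dyn_ball X f \<Lambda> x \<epsilon>)"

text \<open>The infimum is taken in \<^typ>\<open>enat\<close>, so it is \<open>\<infinity>\<close> if the orbit never returns.\<close>

definition return_time ::
  "'a::metric_space set \<Rightarrow> ('a \<Rightarrow> 'a) \<Rightarrow> (nat \<Rightarrow> real \<Rightarrow> nat) \<Rightarrow> nat \<Rightarrow> 'a \<Rightarrow> real \<Rightarrow> enat" where
  "return_time X f g n x \<epsilon> = Inf (enat ` {k. 1 \<le> k \<and> (f ^^ k) x \<in> mistake_ball X f g n x \<epsilon>})"

text \<open>Only applied to values \<open>\<ge> 1\<close>.\<close>

definition ln_enat :: "enat \<Rightarrow> ereal" where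
  "ln_enat r = (case r of enat k \<Rightarrow> ereal (ln (real k)) | \<infinity> \<Rightarrow> \<infinity>)"

definition return_rate ::
  "'a::metric_space set \<Rightarrow> ('a \<Rightarrow> 'a) \<Rightarrow> (nat \<Rightarrow> real \<Rightarrow> nat) \<Rightarrow> nat \<Rightarrow> 'a \<Rightarrow> real \<Rightarrow> ereal" where
  "return_rate X f g n x \<epsilon> = ereal (1 / real n) * ln_enat (return_time X f g n x \<epsilon>)"

definition invariant_measure :: "('a \<Rightarrow> 'a) \<Rightarrow> 'a measure \<Rightarrow> bool" where
  "invariant_measure f \<mu> \<longleftrightarrow> f \<in> measurable \<mu> \<mu> \<and> distr \<mu> \<mu> f = \<mu>"

definition ergodic_measure :: "('a \<Rightarrow> 'a) \<Rightarrow> 'a measure \<Rightarrow> bool" where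
  "ergodic_measure f \<mu> \<longleftrightarrow> invariant_measure f \<mu> \<and>
     (\<forall>A\<in>sets \<mu>. f -` A \<inter> space \<mu> = A \<longrightarrow> measure \<mu> A = 0 \<or> measure \<mu> A = 1)"

definition finite_measurable_partition :: "'a measure \<Rightarrow> 'a set set \<Rightarrow> bool" where
  "finite_measurable_partition \<mu> \<xi> \<longleftrightarrow> finite \<xi> \<and> \<xi> \<subseteq> sets \<mu> \<and> partition_on (space \<mu>) \<xi>"

definition partition_entropy :: "'a measure \<Rightarrow> 'a set set \<Rightarrow> real" where
  "partition_entropy \<mu> \<xi> = - (\<Sum>A\<in>\<xi>. measure \<mu> A * ln (measure \<mu> A))"

text \<open>The partition \<open>f\<^sup>-\<^sup>i \<xi>\<close>; empty preimages are dropped, as \<^const>\<open>partition_on\<close> requires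
  nonempty blocks.\<close>

definition preimage_partition :: "'a measure \<Rightarrow> ('a \<Rightarrow> 'a) \<Rightarrow> nat \<Rightarrow> 'a set set \<Rightarrow> 'a set set" where
  "preimage_partition \<mu> f i \<xi> = (\<lambda>A. (f ^^ i) -` A \<inter> space \<mu>) ` \<xi> - {{}}"

definition iterated_partition :: "'a measure \<Rightarrow> ('a \<Rightarrow> 'a) \<Rightarrow> nat \<Rightarrow> 'a set set \<Rightarrow> 'a set set" where
  "iterated_partition \<mu> f n \<xi> = common_refinement ((\<lambda>i. preimage_partition \<mu> f i \<xi>) ` {0..<n})"

definition entropy_wrt_partition :: "'a measure \<Rightarrow> ('a \<Rightarrow> 'a) \<Rightarrow> 'a set set \<Rightarrow> real" where
  "entropy_wrt_partition \<mu> f \<xi> =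
     lim (\<lambda>n. 1 / real n * partition_entropy \<mu> (iterated_partition \<mu> f n \<xi>))"

definition measure_entropy :: "'a measure \<Rightarrow> ('a \<Rightarrow> 'a) \<Rightarrow> ereal" where
  "measure_entropy \<mu> f =
     (SUP \<xi>\<in>{\<xi>. finite_measurable_partition \<mu> \<xi>}. ereal (entropy_wrt_partition \<mu> f \<xi>))"

end

theory Submission
  imports Defs
begin

text \<open>
  Code the system by a finite-valued map \<open>Y\<close> and write \<open>word Y n x\<close> for its first \<open>n\<close> symbols along the
  orbit of \<open>x\<close>.

  Upper bound: mistakes only enlarge the ball, so if the fibres of \<open>Y\<close> have diameter less than
  \<open>\<epsilon>\<close>, it suffices to bound the return time of the word. By the maximal ergodic theorem a \<open>k\<close>-step Markov
  approximation of the word distribution gives almost every long word a weight of at least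
  \<open>exp (- n a)\<close> for any \<open>a\<close> above the entropy of \<open>Y\<close>, so few words matter; a word returns
  late only with small probability because the preimages of the late-return set are disjoint.
  Conclude by Borel-Cantelli.

  Lower bound: replace \<open>Y\<close> by a map \<open>S\<close> that agrees with \<open>Y\<close> off a set \<open>W\<close> of small measure, such that
  \<open>x \<notin> W\<close> and \<open>dist x y < \<rho>\<close> imply \<open>S x = S y\<close>. A return to the mistake ball within time
  \<open>exp (n c)\<close> then is a repetition of the \<open>S\<close>-word with few errors, and the points having such
  repetitions for infinitely many \<open>n\<close> form an invariant set. If it had full measure, a long word
  could be described by pointers to these repetitions and a list of corrections, so that the entropy of
  \<open>Y\<close> would be at most about \<open>c\<close>.
\<close>

section \<open>Entropy of finite-valued random variables\<close>

text \<open>The dependence of \<open>g\<close> on \<epsilon> is arbitrary, so the rates need not be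
  monotone in \<epsilon>, and null sets cannot be united over uncountably many \<epsilon>. Each
  bound is therefore proved with one null set for a whole range of \<epsilon>: for all \<epsilon>
  below some \<rho> in the lower bound, for all \<epsilon> \<ge> 1 / (q + 1) in the upper one, and
  only for rational thresholds. The obstacle in the lower bound is that nearby points may have
  different symbols. Disjoint compact subsets of the fibres have positive distance, which produces
  \<open>S\<close> and \<rho>; the price is that nothing is known on \<open>W\<close>, so visits to
  \<open>W\<close> count as errors. Only their expected frequency is controlled, so words of small
  total probability may escape the encoding, and the entropy estimate charges these
  \<open>ln m\<close> per letter. A pointer of size at most \<open>exp (n c)\<close> is paid for
  once per block of \<open>n\<close> letters, hence \<open>c\<close> nats per letter. The block
  lengths may vary along the word, but they are bounded before the word length tends to infinity,
  since a pointer must not leave the word.\<close>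

definition pr :: "'a measure \<Rightarrow> ('a \<Rightarrow> 'c) \<Rightarrow> 'c \<Rightarrow> real" where
  "pr M Y w = measure M {x \<in> space M. Y x = w}"

definition ent :: "'a measure \<Rightarrow> ('a \<Rightarrow> 'c) \<Rightarrow> real" where
  "ent M Y = (\<integral>x. - ln (pr M Y (Y x)) \<partial>M)"

context prob_space
begin

lemma fixes Y :: "'a \<Rightarrow> 'c::countable" and h :: "'c \<Rightarrow> real"
  assumes Y[measurable]: "Y \<in> measurable M (count_space UNIV)"
    and W: "finite W" "\<And>x. x \<in> space M \<Longrightarrow> Y x \<in> W"
  shows integrable_finite_range: "integrable M (\<lambda>x. h (Y x))"
    and integral_finite_range: "(\<integral>x. h (Y x) \<partial>M) = (\<Sum>w\<in>W. h w * pr M Y w)"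
proof -
  have eq: "h (Y x) = (\<Sum>w\<in>W. h w * indicator {x \<in> space M. Y x = w} x)" if "x \<in> space M" for x
  proof -
    have "(\<Sum>w\<in>W. h w * indicator {x \<in> space M. Y x = w} x) = (\<Sum>w\<in>W. if w = Y x then h w else 0)"
      using that by (intro sum.cong) (auto simp: indicator_def)
    then show ?thesis using W that by simp
  qed
  have "integrable M (\<lambda>x. \<Sum>w\<in>W. h w * indicator {x \<in> space M. Y x = w} x)"
    by (auto intro!: integrable_real_indicator simp: emeasure_eq_measure)
  then show "integrable M (\<lambda>x. h (Y x))"
    by (subst Bochner_Integration.integrable_cong[OF refl eq])
  have "(\<integral>x. h (Y x) \<partial>M) = (\<integral>x. (\<Sum>w\<in>W. h w * indicator {x \<in> space M. Y x = w} x) \<partial>M)"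
    by (intro Bochner_Integration.integral_cong eq) auto
  also have "\<dots> = (\<Sum>w\<in>W. h w * pr M Y w)"
    by (subst Bochner_Integration.integral_sum)
       (auto intro!: integrable_real_indicator simp: emeasure_eq_measure pr_def)
  finally show "(\<integral>x. h (Y x) \<partial>M) = (\<Sum>w\<in>W. h w * pr M Y w)" .
qed

lemma pr_nonneg: "pr M Y w \<ge> 0" and pr_le_1: "pr M Y w \<le> 1"
  by (auto simp: pr_def)

lemma sum_pr:
  fixes Y :: "'a \<Rightarrow> 'c::countable"
  assumes "Y \<in> measurable M (count_space UNIV)" "finite W" "\<And>x. x \<in> space M \<Longrightarrow> Y x \<in> W"
  shows "(\<Sum>w\<in>W. pr M Y w) = 1"
  using integral_finite_range[OF assms, of "\<lambda>_. 1"] by (simp add: prob_space)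

text \<open>Splitting \<open>ln\<close> over products and quotients of probabilities needs positive
  arguments; this provides them almost everywhere.\<close>

lemma AE_pr_pos:
  fixes Y :: "'a \<Rightarrow> 'c::countable"
  assumes Y[measurable]: "Y \<in> measurable M (count_space UNIV)"
  shows "AE x in M. pr M Y (Y x) > 0"
proof -
  have "AE x in M. \<forall>w. pr M Y w = 0 \<longrightarrow> Y x \<noteq> w"
    unfolding AE_all_countable
  proof (intro allI)
    fix w
    show "AE x in M. pr M Y w = 0 \<longrightarrow> Y x \<noteq> w"
      by (cases "pr M Y w = 0") (auto simp: pr_def prob_eq_0)
  qed
  then show ?thesis
    by eventually_elim (metis pr_nonneg less_eq_real_def)
qed

lemma ent_sum:
  fixes Y :: "'a \<Rightarrow> 'c::countable"
  assumes "Y \<in> measurable M (count_space UNIV)" "finite W" "\<And>x. x \<in> space M \<Longrightarrow> Y x \<in> W"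
  shows "ent M Y = - (\<Sum>w\<in>W. pr M Y w * ln (pr M Y w))"
  unfolding ent_def
  by (subst integral_finite_range[OF assms]) (auto simp: sum_negf[symmetric] intro!: sum.cong)

lemma ent_nonneg: "ent M Y \<ge> 0"
  unfolding ent_def
proof (intro Bochner_Integration.integral_nonneg)
  fix x show "0 \<le> - ln (pr M Y (Y x))"
    using pr_nonneg[of Y "Y x"] pr_le_1[of Y "Y x"] by (cases "pr M Y (Y x) = 0") auto
qed

text \<open>Gibbs' inequality: \<open>ln t \<le> t - 1\<close> at \<open>t = q w / pr M Y w\<close>,
  weighted by \<open>pr M Y w\<close> and summed. Total mass at most 1 suffices for
  \<open>q\<close>. The entropy bounds for pairs and by counting both come from a suitable
  \<open>q\<close>.\<close>

lemma ent_le_cross: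
  fixes Y :: "'a \<Rightarrow> 'c::countable" and q :: "'c \<Rightarrow> real"
  assumes Y: "Y \<in> measurable M (count_space UNIV)" and W: "finite W" "\<And>x. x \<in> space M \<Longrightarrow> Y x \<in> W"
    and q: "\<And>w. w \<in> W \<Longrightarrow> q w \<ge> 0" "(\<Sum>w\<in>W. q w) \<le> 1" "\<And>w. w \<in> W \<Longrightarrow> pr M Y w > 0 \<Longrightarrow> q w > 0"
  shows "ent M Y \<le> (\<integral>x. - ln (q (Y x)) \<partial>M)"
proof -
  have *: "pr M Y w * ln (q w) - pr M Y w * ln (pr M Y w) \<le> q w - pr M Y w" if w: "w \<in> W" for w
  proof (cases "pr M Y w > 0")
    case True
    then have "pr M Y w * ln (q w / pr M Y w) \<le> pr M Y w * (q w / pr M Y w - 1)"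
      using q(3)[OF w] by (intro mult_left_mono ln_le_minus_one) auto
    then show ?thesis using True q(3)[OF w] by (simp add: ln_div algebra_simps)
  next
    case False
    then have "pr M Y w = 0" using pr_nonneg[of Y w] by simp
    then show ?thesis using q(1)[OF w] by simp
  qed
  have "(\<Sum>w\<in>W. pr M Y w * ln (q w) - pr M Y w * ln (pr M Y w)) \<le> (\<Sum>w\<in>W. q w - pr M Y w)"
    by (intro sum_mono *)
  also have "\<dots> \<le> 0" using sum_pr[OF Y W] q(2) by (simp add: sum_subtractf)
  finally show ?thesis
    using integral_finite_range[OF Y W, of "\<lambda>w. - ln (q w)"]
    by (simp add: ent_sum[OF Y W] sum_subtractf sum_negf mult.commute)
qed

text \<open>Compare the joint distribution with the product of its marginals, whose cross entropy is
  the sum of the two entropies.\<close>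

lemma ent_Pair_le:
  fixes Y :: "'a \<Rightarrow> 'c::countable" and Z :: "'a \<Rightarrow> 'd::countable"
  assumes Y[measurable]: "Y \<in> measurable M (count_space UNIV)" and W: "finite W" "\<And>x. x \<in> space M \<Longrightarrow> Y x \<in> W"
    and Z[measurable]: "Z \<in> measurable M (count_space UNIV)" and V: "finite V" "\<And>x. x \<in> space M \<Longrightarrow> Z x \<in> V"
  shows "ent M (\<lambda>x. (Y x, Z x)) \<le> ent M Y + ent M Z"
proof -
  let ?q = "\<lambda>(u, v). pr M Y u * pr M Z v"
  have le: "pr M (\<lambda>x. (Y x, Z x)) (u, v) \<le> pr M Y u" "pr M (\<lambda>x. (Y x, Z x)) (u, v) \<le> pr M Z v" for u v
    unfolding pr_def by (auto intro!: finite_measure_mono)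
  have "ent M (\<lambda>x. (Y x, Z x)) \<le> (\<integral>x. - ln (?q (Y x, Z x)) \<partial>M)"
  proof (rule ent_le_cross[where W = "W \<times> V"])
    show "(\<lambda>x. (Y x, Z x)) \<in> measurable M (count_space UNIV)"
    proof -
      have "(\<lambda>x. (Y x, Z x)) \<in> measurable M (count_space UNIV \<Otimes>\<^sub>M count_space UNIV)" by measurable
      then show ?thesis by (simp add: pair_measure_countable)
    qed
    show "sum ?q (W \<times> V) \<le> 1"
      using sum_pr[OF Y W] sum_pr[OF Z V] by (simp add: sum.cartesian_product[symmetric] sum_product[symmetric])
    show "?q w > 0" if "pr M (\<lambda>x. (Y x, Z x)) w > 0" for w
      using that le[of "fst w" "snd w"] by (cases w) auto
  qed (use W V in \<open>auto intro!: mult_nonneg_nonneg pr_nonneg\<close>)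
  also have "\<dots> = (\<integral>x. - ln (pr M Y (Y x)) + - ln (pr M Z (Z x)) \<partial>M)"
    using AE_pr_pos[OF Y] AE_pr_pos[OF Z]
  proof (intro integral_cong_AE, goal_cases)
    case 3 from 3 show ?case by eventually_elim (auto simp: ln_mult)
  qed measurable
  also have "\<dots> = ent M Y + ent M Z" unfolding ent_def
    by (intro Bochner_Integration.integral_add integrable_finite_range[OF Y W, of "\<lambda>w. - ln (pr M Y w)"]
        integrable_finite_range[OF Z V, of "\<lambda>w. - ln (pr M Z w)"])
  finally show ?thesis .
qed

text \<open>Compare with the mixture of the uniform distributions on \<open>G\<close> and on \<open>W\<close>.\<close>

lemma ent_le_card:
  fixes Y :: "'a \<Rightarrow> 'c::countable" and K L :: real
  assumes Y[measurable]: "Y \<in> measurable M (count_space UNIV)" and W: "finite W" "\<And>x. x \<in> space M \<Longrightarrow> Y x \<in> W"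
    and G: "finite G" "real (card G) \<le> K" "K \<ge> 1" and L: "real (card W) \<le> L" "L \<ge> 1"
    and \<rho>: "measure M {x \<in> space M. Y x \<notin> G} \<le> \<rho>"
  shows "ent M Y \<le> ln 2 + ln K + \<rho> * ln L"
proof -
  let ?q = "\<lambda>w. if w \<in> G then 1 / (2 * K) else 1 / (2 * L)"
  have "sum ?q W \<le> (\<Sum>w\<in>W. indicator G w * (1 / (2 * K)) + 1 / (2 * L))"
    using G L by (intro sum_mono) (auto simp: indicator_def)
  also have "\<dots> = real (card (W \<inter> G)) / (2 * K) + real (card W) / (2 * L)"
    using W by (simp add: sum.distrib sum_divide_distrib[symmetric] indicator_def Int_def)
  also have "\<dots> \<le> 1 / 2 + 1 / 2"
  proof (intro add_mono)
    have "real (card (W \<inter> G)) \<le> K" using G card_mono[of G "W \<inter> G"] by auto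
    then show "real (card (W \<inter> G)) / (2 * K) \<le> 1 / 2" using G by (simp add: field_simps)
    show "real (card W) / (2 * L) \<le> 1 / 2" using L by (simp add: field_simps)
  qed
  finally have "ent M Y \<le> (\<integral>x. - ln (?q (Y x)) \<partial>M)"
    using G L by (intro ent_le_cross[OF Y W]) auto
  also have "\<dots> \<le> (\<integral>x. ln 2 + ln K + indicator {x \<in> space M. Y x \<notin> G} x * ln L \<partial>M)"
  proof (intro integral_mono)
    show "integrable M (\<lambda>x. - ln (?q (Y x)))" by (rule integrable_finite_range[OF Y W, of "\<lambda>w. - ln (?q w)"])
    show "integrable M (\<lambda>x. ln 2 + ln K + indicator {x \<in> space M. Y x \<notin> G} x * ln L)"
      by (auto intro!: integrable_real_indicator simp: emeasure_eq_measure)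
    show "- ln (?q (Y x)) \<le> ln 2 + ln K + indicator {x \<in> space M. Y x \<notin> G} x * ln L" if "x \<in> space M" for x
      using G L that by (auto simp: ln_div ln_mult indicator_def)
  qed
  also have "\<dots> = ln 2 + ln K + measure M {x \<in> space M. Y x \<notin> G} * ln L"
    by (subst Bochner_Integration.integral_add)
       (auto intro!: integrable_real_indicator simp: emeasure_eq_measure prob_space)
  also have "\<dots> \<le> ln 2 + ln K + \<rho> * ln L" using \<rho> L by (intro add_left_mono mult_right_mono) auto
  finally show ?thesis .
qed

lemma pr_inj:
  assumes "inj_on F (Z ` space M)" "x \<in> space M"
  shows "pr M (\<lambda>x. F (Z x)) (F (Z x)) = pr M Z (Z x)"
  unfolding pr_def using assms by (intro arg_cong[where f = "measure M"]) (auto dest: inj_onD)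

lemma ent_inj:
  assumes "inj_on F (Z ` space M)"
  shows "ent M (\<lambda>x. F (Z x)) = ent M Z"
  unfolding ent_def by (intro Bochner_Integration.integral_cong) (auto simp: pr_inj[OF assms])

end

section \<open>Measure-preserving maps and coding words\<close>

text \<open>Fekete's lemma. The limit is the infimum \<open>l\<close> of the quotients: take an
  \<open>m\<close> that almost attains it and divide \<open>n\<close> by \<open>m\<close>; the
  remainder contributes at most the constant \<open>C\<close>, which disappears after division by
  \<open>n\<close>.\<close>

lemma subadditive_convergent:
  fixes u :: "nat \<Rightarrow> real"
  assumes sub: "\<And>m n. u (m + n) \<le> u m + u n" and nn: "\<And>n. u n \<ge> 0"
  shows "convergent (\<lambda>n. u n / real n)"
proof -
  define l where "l = (INF n\<in>{1..}. u n / real n)"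
  have bdd: "bdd_below ((\<lambda>n. u n / real n) ` {1..})"
    using nn by (intro bdd_belowI[of _ 0]) auto
  have ge: "u n / real n \<ge> l" if "n \<ge> 1" for n
    unfolding l_def using that by (intro cINF_lower bdd) auto
  have mult: "u (k * m + r) \<le> real k * u m + u r" for k m r
  proof (induction k)
    case (Suc k)
    have "u (Suc k * m + r) \<le> u m + u (k * m + r)" using sub[of m "k * m + r"] by (simp add: add_ac)
    with Suc show ?case by (simp add: algebra_simps)
  qed simp
  have "(\<lambda>n. u n / real n) \<longlonglongrightarrow> l"
  proof (rule LIMSEQ_I)
    fix e :: real assume e: "e > 0"
    have "\<exists>m\<in>{1..}. u m / real m < l + e / 2"
      using e bdd by (subst cINF_less_iff[symmetric]) (auto simp: l_def)
    then obtain m where m: "m \<ge> 1" "u m / real m < l + e / 2" by auto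
    define C where "C = (\<Sum>r<m. u r)"
    have C: "u r \<le> C" if "r < m" for r
      unfolding C_def using that nn by (intro member_le_sum) auto
    have "C \<ge> 0" unfolding C_def using nn by (intro sum_nonneg) auto
    obtain N where N: "real N > 2 * C / e" using reals_Archimedean2 by blast
    show "\<exists>no. \<forall>n\<ge>no. norm (u n / real n - l) < e"
    proof (intro exI[of _ "max N 1"] allI impI)
      fix n assume n: "max N 1 \<le> n"
      have "u n \<le> real (n div m) * u m + u (n mod m)" using mult[of "n div m" m "n mod m"] by simp
      also have "\<dots> \<le> real n / real m * u m + C"
      proof (intro add_mono mult_right_mono C nn)
        show "real (n div m) \<le> real n / real m" by (rule of_nat_div_le_of_nat)
      qed (use m in auto)
      finally have "u n / real n \<le> u m / real m + C / real n"
        using n m by (simp add: field_simps)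
      moreover have "C / real n < e / 2"
      proof -
        have "2 * C / e < real n" using N n by linarith
        then show ?thesis using e n by (simp add: field_simps)
      qed
      ultimately have "u n / real n < l + e" using m by linarith
      with ge[of n] n show "norm (u n / real n - l) < e" by auto
    qed
  qed
  then show ?thesis by (auto simp: convergent_def)
qed

locale mpt = prob_space M for M :: "'a measure" +
  fixes T :: "'a \<Rightarrow> 'a"
  assumes T_measurable[measurable]: "T \<in> measurable M M"
    and T_distr: "distr M M T = M"
begin

lemma funpow_measurable[measurable]: "(T ^^ n) \<in> measurable M M"
  by (induction n) (auto intro: measurable_comp)

lemma funpow_space: "x \<in> space M \<Longrightarrow> (T ^^ n) x \<in> space M"
  using funpow_measurable by (rule measurable_space)

lemma funpow_distr: "distr M M (T ^^ n) = M"
proof (induction n)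
  case 0 then show ?case by (simp add: id_def distr_id2)
next
  case (Suc n)
  have "distr M M (T ^^ Suc n) = distr (distr M M (T ^^ n)) M T" by (simp add: distr_distr)
  then show ?case unfolding Suc T_distr .
qed

lemma prob_funpow:
  assumes [measurable]: "Measurable.pred M P"
  shows "measure M {x \<in> space M. P ((T ^^ n) x)} = measure M {x \<in> space M. P x}"
proof -
  have "measure M {x \<in> space M. P x} = measure (distr M M (T ^^ n)) {x \<in> space M. P x}"
    by (simp add: funpow_distr)
  also have "\<dots> = measure M {x \<in> space M. P ((T ^^ n) x)}"
    by (subst measure_distr) (auto intro!: arg_cong[where f = "measure M"] funpow_space)
  finally show ?thesis ..
qed

lemma AE_funpow:
  assumes "AE x in M. P x"
  shows "AE x in M. \<forall>n. P ((T ^^ n) x)"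
  unfolding AE_all_countable
proof
  fix n
  obtain N where N: "N \<in> null_sets M" "\<And>x. x \<in> space M \<Longrightarrow> x \<notin> N \<Longrightarrow> P x"
    using assms by (auto elim!: AE_E3)
  then have [measurable]: "N \<in> sets M" by auto
  have "measure M {x \<in> space M. (T ^^ n) x \<in> N} = 0"
    using prob_funpow[of "\<lambda>x. x \<in> N" n] N by (auto simp: null_setsD1 measure_def Int_def[symmetric])
  then have "AE x in M. (T ^^ n) x \<notin> N" by (subst (asm) prob_eq_0) auto
  then show "AE x in M. P ((T ^^ n) x)" using AE_space
    by eventually_elim (use N funpow_space in auto)
qed

lemma integral_funpow:
  fixes h :: "'a \<Rightarrow> real"
  assumes [measurable]: "h \<in> borel_measurable M"
  shows "(\<integral>x. h ((T ^^ n) x) \<partial>M) = (\<integral>x. h x \<partial>M)"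
  using integral_distr[OF funpow_measurable[of n] assms] by (simp add: funpow_distr)

definition word :: "('a \<Rightarrow> nat) \<Rightarrow> nat \<Rightarrow> 'a \<Rightarrow> nat list" where
  "word Y n x = map (\<lambda>i. Y ((T ^^ i) x)) [0..<n]"

lemma length_word[simp]: "length (word Y n x) = n"
  by (simp add: word_def)

lemma word_nth[simp]: "i < n \<Longrightarrow> word Y n x ! i = Y ((T ^^ i) x)"
  by (simp add: word_def)

lemma word_0[simp]: "word Y 0 x = []"
  by (simp add: word_def)

lemma word_Suc: "word Y (Suc n) x = Y x # word Y n (T x)"
  unfolding word_def by (subst upt_conv_Cons) (auto simp: map_Suc_upt[symmetric] funpow_swap1 simp del: upt_Suc)

lemma word_add: "word Y (m + n) x = word Y m x @ word Y n ((T ^^ m) x)"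
  by (induction m arbitrary: x) (auto simp: word_Suc funpow_swap1)

lemma take_word: "take k (word Y n x) = word Y (min k n) x"
  unfolding word_def by (simp add: take_map take_upt min_def)

lemma word_measurable[measurable]:
  assumes [measurable]: "Y \<in> measurable M (count_space UNIV)"
  shows "word Y n \<in> measurable M (count_space UNIV)"
proof (induction n)
  case (Suc n)
  note [measurable] = Suc
  have "word Y (Suc n) = (\<lambda>x. case (Y x, word Y n (T x)) of (a, w) \<Rightarrow> a # w)" by (simp add: word_Suc fun_eq_iff)
  also have "\<dots> \<in> measurable M (count_space UNIV)" by measurable
  finally show ?case .
qed simp

definition words :: "nat \<Rightarrow> nat \<Rightarrow> nat list set" where
  "words m n = {w. set w \<subseteq> {..<m} \<and> length w = n}"

lemma finite_words[simp]: "finite (words m n)"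
  unfolding words_def by (simp add: finite_lists_length_eq)

lemma card_words: "card (words m n) = m ^ n"
  unfolding words_def by (simp add: card_lists_length_eq)

end

locale coded_mpt = mpt +
  fixes Y :: "'a \<Rightarrow> nat" and m :: nat
  assumes Y_measurable[measurable]: "Y \<in> measurable M (count_space UNIV)"
    and Y_less: "\<And>x. x \<in> space M \<Longrightarrow> Y x < m"
begin

lemma word_in_words: "x \<in> space M \<Longrightarrow> word Y n x \<in> words m n"
  by (auto simp: words_def word_def funpow_space Y_less)

lemma pr_word_funpow: "measure M {x \<in> space M. word Y n ((T ^^ k) x) = w} = pr M (word Y n) w"
  unfolding pr_def by (rule prob_funpow) measurable

text \<open>Concatenation is injective once the length of the first factor is fixed, and by
  invariance the second factor is distributed like \<open>word Y n\<close>.\<close>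

lemma ent_word_add: "ent M (word Y (k + n)) \<le> ent M (word Y k) + ent M (word Y n)"
proof -
  have "ent M (word Y (k + n)) = ent M (\<lambda>x. (\<lambda>(u, v). u @ v) (word Y k x, word Y n ((T ^^ k) x)))"
    by (intro arg_cong[where f = "ent M"]) (simp add: word_add fun_eq_iff)
  also have "\<dots> = ent M (\<lambda>x. (word Y k x, word Y n ((T ^^ k) x)))"
    by (rule ent_inj) (auto simp: inj_on_def)
  also have "\<dots> \<le> ent M (word Y k) + ent M (\<lambda>x. word Y n ((T ^^ k) x))"
    by (rule ent_Pair_le[where W = "words m k" and V = "words m n"]) (auto intro!: word_in_words funpow_space)
  also have "ent M (\<lambda>x. word Y n ((T ^^ k) x)) = ent M (word Y n)"
    unfolding ent_def pr_def[of M "\<lambda>x. word Y n ((T ^^ k) x)"] pr_word_funpow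
    by (rule integral_funpow) measurable
  finally show ?thesis .
qed

text \<open>The entropy of the transformation with respect to the partition into the fibres of
  \<open>Y\<close>, as \<open>entropy_wrt_fibres\<close> confirms.\<close>

definition rate :: real where
  "rate = lim (\<lambda>n. ent M (word Y n) / real n)"

lemma ent_word_tendsto: "(\<lambda>n. ent M (word Y n) / real n) \<longlonglongrightarrow> rate"
  unfolding rate_def convergent_LIMSEQ_iff[symmetric]
  by (intro subadditive_convergent ent_word_add ent_nonneg)

lemma rate_nonneg: "rate \<ge> 0"
  by (rule LIMSEQ_le_const[OF ent_word_tendsto]) (auto intro!: ent_nonneg divide_nonneg_nonneg)

text \<open>The increments telescope to \<open>ent M (word Y n)\<close>, so they cannot all exceed \<open>a\<close>.\<close>

lemma small_increment:
  assumes "rate < a"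
  obtains n where "ent M (word Y (Suc n)) - ent M (word Y n) < a"
proof (rule ccontr)
  assume "\<not> thesis"
  with that have *: "ent M (word Y (Suc n)) - ent M (word Y n) \<ge> a" for n by (meson not_less)
  have "ent M (word Y n) \<ge> a * real n" for n
  proof (induction n)
    case (Suc n)
    with *[of n] show ?case by (simp add: algebra_simps)
  qed (simp add: ent_nonneg)
  then have "ent M (word Y n) / real n \<ge> a" if "n \<ge> 1" for n using that by (simp add: field_simps)
  then have "rate \<ge> a" by (intro LIMSEQ_le_const[OF ent_word_tendsto]) blast
  with assms show False by simp
qed

end

section \<open>The maximal ergodic theorem\<close>

locale ergodic_mpt = mpt +
  assumes ergodic: "A \<in> sets M \<Longrightarrow> T -` A \<inter> space M = A \<Longrightarrow> measure M A = 0 \<or> measure M A = 1"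

context mpt
begin

definition birkhoff :: "('a \<Rightarrow> real) \<Rightarrow> nat \<Rightarrow> 'a \<Rightarrow> real" where
  "birkhoff h n x = (\<Sum>i<n. h ((T ^^ i) x))"

lemma birkhoff_0[simp]: "birkhoff h 0 x = 0"
  by (simp add: birkhoff_def)

lemma birkhoff_Suc: "birkhoff h (Suc n) x = h x + birkhoff h n (T x)"
  by (simp add: birkhoff_def sum.lessThan_Suc_shift funpow_swap1 del: sum.lessThan_Suc)

lemma birkhoff_measurable[measurable]:
  assumes [measurable]: "h \<in> borel_measurable M"
  shows "birkhoff h n \<in> borel_measurable M"
  unfolding birkhoff_def by measurable

text \<open>The empty sum \<open>n = 0\<close> takes part in the maximum, so the maximum is never
  negative and is 0 wherever it fails to be positive. The second case in
  \<open>maximal_ergodic\<close> rests on this.\<close>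

definition max_birkhoff :: "('a \<Rightarrow> real) \<Rightarrow> nat \<Rightarrow> 'a \<Rightarrow> real" where
  "max_birkhoff h N x = Max ((\<lambda>n. birkhoff h n x) ` {..N})"

lemma max_birkhoff_ge: "n \<le> N \<Longrightarrow> birkhoff h n x \<le> max_birkhoff h N x"
  unfolding max_birkhoff_def by (intro Max_ge) auto

lemma max_birkhoff_attained: obtains n where "n \<le> N" "max_birkhoff h N x = birkhoff h n x"
proof -
  have "max_birkhoff h N x \<in> (\<lambda>n. birkhoff h n x) ` {..N}"
    unfolding max_birkhoff_def by (rule Max_in) auto
  then show thesis using that by auto
qed

lemma max_birkhoff_nonneg: "max_birkhoff h N x \<ge> 0"
  using max_birkhoff_ge[of 0 N h x] by simp

lemma max_birkhoff_measurable[measurable]: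
  assumes [measurable]: "h \<in> borel_measurable M"
  shows "max_birkhoff h N \<in> borel_measurable M"
  unfolding max_birkhoff_def by measurable

text \<open>Garsia's argument: on \<open>{max_birkhoff h N > 0}\<close> the maximum is attained at some \<open>n \<ge> 1\<close>,
  so there \<open>max_birkhoff h N x \<le> h x + max_birkhoff h N (T x)\<close>.\<close>

lemma maximal_ergodic:
  assumes [measurable]: "h \<in> borel_measurable M" and bdd: "\<And>x. x \<in> space M \<Longrightarrow> \<bar>h x\<bar> \<le> C"
  shows "(\<integral>x. indicator {x \<in> space M. max_birkhoff h N x > 0} x * h x \<partial>M) \<ge> 0"
proof -
  let ?F = "max_birkhoff h N"
  have b: "\<bar>birkhoff h n x\<bar> \<le> real n * C" if "x \<in> space M" for n x
    unfolding birkhoff_def using sum_norm_le[of "{..<n}" "\<lambda>i. h ((T ^^ i) x)" "\<lambda>_. C"] bdd funpow_space that by auto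
  have bF: "\<bar>?F x\<bar> \<le> real N * \<bar>C\<bar>" if "x \<in> space M" for x
  proof -
    obtain n where n: "n \<le> N" "?F x = birkhoff h n x" by (rule max_birkhoff_attained)
    have "real n * C \<le> real n * \<bar>C\<bar>" by (intro mult_left_mono) auto
    also have "\<dots> \<le> real N * \<bar>C\<bar>" using n(1) by (intro mult_right_mono) auto
    finally have "real n * C \<le> real N * \<bar>C\<bar>" .
    then show ?thesis using b[OF that, of n] n by simp
  qed
  have TM: "T x \<in> space M" if "x \<in> space M" for x using funpow_space[OF that, of 1] by simp
  have int: "integrable M ?F" "integrable M (\<lambda>x. ?F (T x))"
    by (rule integrable_const_bound[of _ "real N * \<bar>C\<bar>"]; use bF TM in \<open>auto intro!: AE_I2\<close>)+
  have "0 = (\<integral>x. ?F x - ?F (T x) \<partial>M)"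
    using integral_funpow[of ?F 1] int by simp
  also have "\<dots> \<le> (\<integral>x. indicator {x \<in> space M. ?F x > 0} x * h x \<partial>M)"
  proof (intro integral_mono)
    show "integrable M (\<lambda>x. ?F x - ?F (T x))" using int by auto
    show "integrable M (\<lambda>x. indicator {x \<in> space M. ?F x > 0} x * h x)"
      by (rule integrable_const_bound[of _ "\<bar>C\<bar>"]) (use bdd in \<open>auto simp: indicator_def intro!: AE_I2 order_trans[OF bdd]\<close>)
    show "?F x - ?F (T x) \<le> indicator {x \<in> space M. ?F x > 0} x * h x" if x: "x \<in> space M" for x
    proof (cases "?F x > 0")
      case True
      obtain n where n: "n \<le> N" "?F x = birkhoff h n x" by (rule max_birkhoff_attained)
      with True obtain k where k: "n = Suc k" by (cases n) auto
      have "birkhoff h k (T x) \<le> ?F (T x)" using n k by (intro max_birkhoff_ge) auto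
      then show ?thesis using True n k x by (simp add: birkhoff_Suc)
    next
      case False
      then show ?thesis using max_birkhoff_nonneg[of h N "T x"] by simp
    qed
  qed
  finally show ?thesis .
qed

end

context ergodic_mpt
begin

text \<open>Let \<open>B\<close> be the set where the Birkhoff sums of \<open>h - a\<close> are
  unbounded above. Dropping or prepending one term changes a sum by at most \<open>D\<close>, so
  \<open>B\<close> is invariant. If \<open>B\<close> had measure 1, the events in
  \<open>maximal_ergodic\<close> would increase to a set of full measure, and the integral of
  \<open>h - a\<close> would be nonnegative, contrary to the choice of \<open>a\<close>.\<close>

lemma birkhoff_upper:
  assumes [measurable]: "h \<in> borel_measurable M" and bdd: "\<And>x. x \<in> space M \<Longrightarrow> \<bar>h x\<bar> \<le> C"
    and a: "(\<integral>x. h x \<partial>M) < a"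
  shows "AE x in M. \<exists>K. \<forall>n. birkhoff h n x \<le> a * real n + K"
proof -
  let ?p = "\<lambda>x. h x - a"
  define B where "B = {x \<in> space M. \<forall>K::nat. \<exists>n. birkhoff ?p n x > real K}"
  have TM: "T x \<in> space M" if "x \<in> space M" for x using funpow_space[OF that, of 1] by simp
  have [measurable]: "B \<in> sets M" unfolding B_def by measurable
  have pb: "\<bar>?p x\<bar> \<le> C + \<bar>a\<bar>" if "x \<in> space M" for x using bdd[OF that] by linarith
  have int: "integrable M h"
    by (rule integrable_const_bound[of _ C]) (use bdd in \<open>auto intro!: AE_I2\<close>)
  obtain D :: nat where D: "C + \<bar>a\<bar> \<le> real D" using real_arch_simple by blast
  have pD: "\<bar>?p x\<bar> \<le> real D" if "x \<in> space M" for x using pb[OF that] D by linarith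
  have "T -` B \<inter> space M = B"
  proof (intro set_eqI iffI)
    fix x assume x: "x \<in> T -` B \<inter> space M"
    have "\<exists>n. birkhoff ?p n x > real K" for K :: nat
    proof -
      obtain n where "birkhoff ?p n (T x) > real (K + D)" using x unfolding B_def by blast
      then have "birkhoff ?p (Suc n) x > real K" using pD[of x] x by (auto simp: birkhoff_Suc)
      then show ?thesis by blast
    qed
    then show "x \<in> B" using x by (auto simp: B_def)
  next
    fix x assume x: "x \<in> B"
    have xM: "x \<in> space M" using x by (auto simp: B_def)
    have "\<exists>n. birkhoff ?p n (T x) > real K" for K :: nat
    proof -
      obtain n where n: "birkhoff ?p n x > real (K + D)" using x unfolding B_def by blast
      then obtain k where k: "n = Suc k" by (cases n) auto
      then have "birkhoff ?p k (T x) > real K" using pD[OF xM] n by (auto simp: birkhoff_Suc)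
      then show ?thesis by blast
    qed
    then show "x \<in> T -` B \<inter> space M" using xM TM by (auto simp: B_def)
  qed
  then consider "prob B = 0" | "prob B = 1" using ergodic[of B] by auto
  then have "prob B = 0"
  proof cases
    case 2
    let ?P = "\<lambda>N. {x \<in> space M. max_birkhoff ?p N x > 0}"
    have "(\<lambda>N. \<integral>x. indicator (?P N) x * ?p x \<partial>M) \<longlonglongrightarrow> (\<integral>x. ?p x \<partial>M)"
    proof (rule integral_dominated_convergence[where w = "\<lambda>_. C + \<bar>a\<bar>"])
      have "AE x in M. x \<in> B" using 2 by (simp add: prob_eq_1)
      then show "AE x in M. (\<lambda>N. indicator (?P N) x * ?p x) \<longlonglongrightarrow> ?p x"
      proof eventually_elim
        case (elim x)
        then obtain n where n: "birkhoff ?p n x > real 0" unfolding B_def by blast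
        have "eventually (\<lambda>N. indicator (?P N) x * ?p x = ?p x) sequentially"
          using eventually_ge_at_top[of n]
        proof eventually_elim
          case (elim N)
          then have "max_birkhoff ?p N x > 0" using n max_birkhoff_ge[of n N ?p x] by simp
          then show ?case using \<open>x \<in> B\<close> by (simp add: B_def)
        qed
        then show ?case by (rule tendsto_eventually)
      qed
      show "AE x in M. norm (indicator (?P N) x * ?p x) \<le> C + \<bar>a\<bar>" for N
      proof (rule AE_I2)
        fix x assume "x \<in> space M"
        then show "norm (indicator (?P N) x * ?p x) \<le> C + \<bar>a\<bar>"
          using pb[of x] by (auto simp: indicator_def)
      qed
    qed auto
    moreover have "(\<integral>x. indicator (?P N) x * ?p x \<partial>M) \<ge> 0" for N
      by (rule maximal_ergodic[of ?p, OF _ pb]) auto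
    ultimately have "(\<integral>x. ?p x \<partial>M) \<ge> 0" by (intro LIMSEQ_le_const) auto
    then show ?thesis using int a by (simp add: prob_space)
  qed
  then have "AE x in M. x \<notin> B" by (simp add: prob_eq_0)
  then show ?thesis using AE_space
  proof eventually_elim
    case (elim x)
    then obtain K :: nat where K: "\<And>n. birkhoff ?p n x \<le> real K" by (auto simp: B_def not_less)
    have "birkhoff ?p n x = birkhoff h n x - a * real n" for n
      by (simp add: birkhoff_def sum_subtractf)
    with K have "birkhoff h n x \<le> a * real n + real K" for n by (simp add: algebra_simps)
    then show ?case by blast
  qed
qed

end

section \<open>Return times of words\<close>

text \<open>The \<open>K + 1\<close> preimages \<open>?A j\<close> have equal measure by invariance.
  They are disjoint: a point common to numbers \<open>i < j\<close> would satisfy \<open>P\<close>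
  at time \<open>j\<close>, which is a return at most \<open>K\<close> steps after time
  \<open>i\<close>.\<close>

lemma (in mpt) prob_late_return:
  assumes [measurable]: "Measurable.pred M P"
  shows "real (Suc K) * measure M {x \<in> space M. P x \<and> (\<forall>k\<in>{1..K}. \<not> P ((T ^^ k) x))} \<le> 1"
proof -
  let ?E = "\<lambda>x. P x \<and> (\<forall>k\<in>{1..K}. \<not> P ((T ^^ k) x))"
  let ?A = "\<lambda>j. {x \<in> space M. ?E ((T ^^ j) x)}"
  have disj: "?A i \<inter> ?A j = {}" if "i < j" "j \<le> K" for i j
  proof -
    have False if "x \<in> ?A i" "x \<in> ?A j" for x
    proof -
      have "(T ^^ j) x = (T ^^ (j - i)) ((T ^^ i) x)"
        using \<open>i < j\<close> by (metis comp_apply funpow_add le_add_diff_inverse2 less_imp_le)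
      moreover have "j - i \<in> {1..K}" using \<open>i < j\<close> \<open>j \<le> K\<close> by auto
      ultimately show False using that by auto
    qed
    then show ?thesis by blast
  qed
  have "real (Suc K) * measure M {x \<in> space M. ?E x} = (\<Sum>j\<in>{..K}. measure M (?A j))"
  proof -
    have "measure M (?A j) = measure M {x \<in> space M. ?E x}" for j
      by (rule prob_funpow) measurable
    then show ?thesis by simp
  qed
  also have "\<dots> = measure M (\<Union>j\<in>{..K}. ?A j)"
  proof (intro finite_measure_finite_Union[symmetric])
    show "disjoint_family_on ?A {..K}"
      unfolding disjoint_family_on_def
    proof (intro ballI impI)
      fix i j assume "i \<in> {..K}" "j \<in> {..K}" "i \<noteq> j"
      then show "?A i \<inter> ?A j = {}" using disj[of i j] disj[of j i] by (cases i j rule: linorder_cases) auto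
    qed
    have "?A j \<in> sets M" for j by measurable
    then show "?A ` {..K} \<subseteq> sets M" by blast
  qed simp
  also have "\<dots> \<le> 1" by simp
  finally show ?thesis .
qed

section \<open>Markov weights of words and conditional information\<close>

context coded_mpt
begin

lemma m_pos: "m > 0"
  using not_empty Y_less by fastforce

text \<open>The chain is run from right to left: each letter gets its conditional probability given
  the \<open>N\<close> letters after it. This direction fits \<open>word_Suc\<close>, so that the
  weight of a word becomes a product along the orbit. The last \<open>N\<close> letters get the
  factor 1 instead of their true probability, so the total mass exceeds 1, but only by a factor that
  does not grow with the length.\<close>

fun markov_weight :: "nat \<Rightarrow> nat list \<Rightarrow> real" where
  "markov_weight N [] = 1"
| "markov_weight N (a # w) = (if length w < N then 1
     else pr M (word Y (Suc N)) (a # take N w) / pr M (word Y N) (take N w)) * markov_weight N w"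

lemma markov_weight_nonneg: "markov_weight N w \<ge> 0"
  by (induction w) (auto intro!: mult_nonneg_nonneg divide_nonneg_nonneg pr_nonneg)

lemma sum_pr_Cons_le: "(\<Sum>a<m. pr M (word Y (Suc N)) (a # u)) \<le> pr M (word Y N) u"
proof -
  let ?A = "\<lambda>a. {x \<in> space M. word Y (Suc N) x = a # u}"
  have A: "?A a \<in> sets M" for a by measurable
  have "(\<Sum>a<m. pr M (word Y (Suc N)) (a # u)) = measure M (\<Union>a<m. ?A a)"
    unfolding pr_def using A by (intro finite_measure_finite_Union[symmetric]) (auto simp: disjoint_family_on_def)
  also have "\<dots> \<le> measure M {x \<in> space M. word Y N ((T ^^ 1) x) = u}"
    by (intro finite_measure_mono) (auto simp: word_Suc)
  also have "\<dots> = pr M (word Y N) u" by (rule pr_word_funpow)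
  finally show ?thesis .
qed

lemma words_Suc: "words m (Suc n) = (\<lambda>(a, w). a # w) ` ({..<m} \<times> words m n)"
  by (auto simp: words_def length_Suc_conv image_iff)

text \<open>Summing out the first letter costs a factor \<open>m\<close> while fewer than
  \<open>N\<close> letters follow it, and a factor of at most 1 from then on.\<close>

lemma sum_markov_weight: "(\<Sum>w\<in>words m n. markov_weight N w) \<le> real m ^ min n N"
proof (induction n)
  case 0
  have "words m 0 = {[]}" by (auto simp: words_def)
  then show ?case by simp
next
  case (Suc n)
  let ?c = "\<lambda>a w. if n < N then 1 else pr M (word Y (Suc N)) (a # take N w) / pr M (word Y N) (take N w)"
  have c: "(\<Sum>a<m. ?c a w) \<le> (if n < N then real m else 1)" for w
  proof (cases "n < N")
    case False
    have "(\<Sum>a<m. ?c a w) = (\<Sum>a<m. pr M (word Y (Suc N)) (a # take N w)) / pr M (word Y N) (take N w)"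
      using False by (simp add: sum_divide_distrib)
    \<comment> \<open>A vanishing denominator makes the quotient 0.\<close>
    also have "\<dots> \<le> 1"
      using sum_pr_Cons_le[of N "take N w"] pr_nonneg[of "word Y N" "take N w"]
      by (auto simp: divide_le_eq_1 less_eq_real_def)
    finally show ?thesis using False by simp
  qed simp
  have "(\<Sum>w\<in>words m (Suc n). markov_weight N w) = (\<Sum>(a, w)\<in>{..<m} \<times> words m n. markov_weight N (a # w))"
    unfolding words_Suc by (subst sum.reindex) (auto simp: inj_on_def case_prod_beta)
  also have "\<dots> = (\<Sum>w\<in>words m n. \<Sum>a<m. ?c a w * markov_weight N w)"
    by (subst sum.cartesian_product[symmetric], subst sum.swap) (auto intro!: sum.cong simp: words_def)
  also have "\<dots> = (\<Sum>w\<in>words m n. (\<Sum>a<m. ?c a w) * markov_weight N w)"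
    by (simp add: sum_distrib_right)
  also have "\<dots> \<le> (\<Sum>w\<in>words m n. (if n < N then real m else 1) * markov_weight N w)"
    by (intro sum_mono mult_right_mono c markov_weight_nonneg)
  also have "\<dots> = (if n < N then real m else 1) * (\<Sum>w\<in>words m n. markov_weight N w)"
    by (simp add: sum_distrib_left)
  also have "\<dots> \<le> (if n < N then real m else 1) * real m ^ min n N"
    using Suc by (intro mult_left_mono) auto
  also have "\<dots> = real m ^ min (Suc n) N" by (cases n N rule: linorder_cases) (auto simp: min_def)
  finally show ?case .
qed

text \<open>The conditional information of the first symbol given the next \<open>N\<close>. Along
  almost every orbit its Birkhoff sums are the negative logarithms of the Markov weights, and its
  integral is an entropy increment, to which \<open>small_increment\<close> applies.\<close>

definition info :: "nat \<Rightarrow> 'a \<Rightarrow> real" where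
  "info N x = - ln (pr M (word Y (Suc N)) (word Y (Suc N) x) / pr M (word Y N) (word Y N (T x)))"

lemma info_measurable[measurable]: "info N \<in> borel_measurable M"
  unfolding info_def by measurable

text \<open>Only the word of length \<open>N + 1\<close> matters, because the word of
  \<open>T x\<close> is its tail; hence there are finitely many values.\<close>

lemma info_bounded: obtains C where "\<And>x. x \<in> space M \<Longrightarrow> \<bar>info N x\<bar> \<le> C"
proof -
  let ?h = "\<lambda>w. \<bar>ln (pr M (word Y (Suc N)) w / pr M (word Y N) (tl w))\<bar>"
  show thesis
  proof (rule that)
    fix x assume "x \<in> space M"
    then have "?h (word Y (Suc N) x) \<le> (\<Sum>w\<in>words m (Suc N). ?h w)"
      by (intro member_le_sum word_in_words) auto
    then show "\<bar>info N x\<bar> \<le> (\<Sum>w\<in>words m (Suc N). ?h w)"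
      by (simp add: info_def word_Suc)
  qed
qed

lemma integral_info: "(\<integral>x. info N x \<partial>M) = ent M (word Y (Suc N)) - ent M (word Y N)"
proof -
  have pos: "AE x in M. pr M (word Y N) (word Y N (T x)) > 0"
    using AE_funpow[OF AE_pr_pos[OF word_measurable[OF Y_measurable, of N]]]
    by eventually_elim (drule spec[of _ 1], simp)
  have int: "integrable M (\<lambda>x. - ln (pr M (word Y n) (word Y n x)))"
    "integrable M (\<lambda>x. - ln (pr M (word Y n) (word Y n (T x))))" for n
    by (rule integrable_finite_range[of _ "words m n" "\<lambda>w. - ln (pr M (word Y n) w)"];
        use word_in_words measurable_space[OF T_measurable] in force)+
  have "(\<integral>x. info N x \<partial>M) = (\<integral>x. - ln (pr M (word Y (Suc N)) (word Y (Suc N) x))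
      - - ln (pr M (word Y N) (word Y N (T x))) \<partial>M)"
    using AE_pr_pos[OF word_measurable[OF Y_measurable, of "Suc N"]] pos
  proof (intro integral_cong_AE, goal_cases)
    case 3 from 3 show ?case by eventually_elim (simp add: info_def ln_div)
  qed measurable
  also have "\<dots> = ent M (word Y (Suc N)) - (\<integral>x. - ln (pr M (word Y N) (word Y N (T x))) \<partial>M)"
    unfolding ent_def using int by (intro Bochner_Integration.integral_diff)
  also have "(\<integral>x. - ln (pr M (word Y N) (word Y N (T x))) \<partial>M) = ent M (word Y N)"
    unfolding ent_def
    using integral_funpow[of "\<lambda>x. - ln (pr M (word Y N) (word Y N x))" 1] by simp
  finally show ?thesis .
qed

text \<open>Positivity along the orbit makes each factor equal to \<open>exp (- info N)\<close> at a
  point of the orbit. The subtraction is truncated: for \<open>n \<le> N\<close> both sides are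
  1.\<close>

lemma markov_weight_word:
  assumes "\<And>k. pr M (word Y (Suc N)) (word Y (Suc N) ((T ^^ k) x)) > 0"
    "\<And>k. pr M (word Y N) (word Y N ((T ^^ k) x)) > 0"
  shows "markov_weight N (word Y n x) = exp (- birkhoff (info N) (n - N) x)"
  using assms
proof (induction n arbitrary: x)
  case (Suc n)
  have pos: "pr M (word Y (Suc N)) (word Y (Suc N) ((T ^^ k) (T x))) > 0"
      "pr M (word Y N) (word Y N ((T ^^ k) (T x))) > 0" for k
    using Suc.prems[of "Suc k"] by (simp_all add: funpow_swap1)
  have IH: "markov_weight N (word Y n (T x)) = exp (- birkhoff (info N) (n - N) (T x))"
    by (rule Suc.IH[OF pos])
  show ?case
  proof (cases "n < N")
    case True
    then show ?thesis using IH by (simp add: word_Suc)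
  next
    case False
    have "exp (- info N x) = pr M (word Y (Suc N)) (word Y (Suc N) x) / pr M (word Y N) (word Y N (T x))"
      unfolding info_def using Suc.prems(1)[of 0] pos(2)[of 0] by simp
    moreover have "Suc n - N = Suc (n - N)" using False by auto
    moreover have "exp (- (info N x + b)) = exp (- info N x) * exp (- b)" for b
      by (simp add: exp_add[symmetric])
    ultimately show ?thesis using False IH
      by (simp add: word_Suc take_word birkhoff_Suc min_absorb1)
  qed
qed simp

end

section \<open>Return times of cylinders\<close>

locale ergodic_coded_mpt = ergodic_mpt + coded_mpt
begin

lemma cylinder_return_time:
  assumes "rate < c"
  shows "AE x in M. eventually (\<lambda>n. \<exists>k\<ge>1. real k \<le> exp (c * real n) \<and> word Y n ((T ^^ k) x) = word Y n x) sequentially"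
proof -
  \<comment> \<open>Three rates separate the errors: \<open>a\<close> bounds the growth of the
    information sums, the gap from \<open>a\<close> to \<open>c1\<close> absorbs the constant that
    depends on the point, and the gap from \<open>c1\<close> to \<open>c\<close> makes the
    probabilities of late return summable.\<close>
  obtain a where a: "rate < a" "a < c" using assms dense by blast
  obtain c1 where c1: "a < c1" "c1 < c" using a dense by blast
  obtain N where N: "ent M (word Y (Suc N)) - ent M (word Y N) < a" using small_increment[OF a(1)] .
  obtain C where C: "\<And>x. x \<in> space M \<Longrightarrow> \<bar>info N x\<bar> \<le> C" using info_bounded[of N] by blast
  have bk: "AE x in M. \<exists>K. \<forall>n. birkhoff (info N) n x \<le> a * real n + K"
    by (rule birkhoff_upper[OF _ C]) (use N in \<open>simp_all add: integral_info\<close>)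
  define G where "G n = {w \<in> words m n. markov_weight N w \<ge> exp (- c1 * real n)}" for n
  have Gfin: "finite (G n)" for n unfolding G_def by auto
  have cardG: "real (card (G n)) \<le> real m ^ N * exp (c1 * real n)" for n
  proof -
    have "real (card (G n)) * exp (- c1 * real n) \<le> (\<Sum>w\<in>G n. markov_weight N w)"
      using sum_mono[of "G n" "\<lambda>_. exp (- c1 * real n)" "markov_weight N"] by (simp add: G_def)
    also have "\<dots> \<le> (\<Sum>w\<in>words m n. markov_weight N w)"
      by (intro sum_mono2) (auto simp: G_def markov_weight_nonneg)
    also have "\<dots> \<le> real m ^ min n N" by (rule sum_markov_weight)
    also have "\<dots> \<le> real m ^ N" using m_pos by (intro power_increasing) auto
    finally show ?thesis by (simp add: exp_minus field_simps)
  qed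
  have good: "AE x in M. eventually (\<lambda>n. word Y n x \<in> G n) sequentially"
    using bk AE_funpow[OF AE_pr_pos[OF word_measurable[OF Y_measurable, of N]]]
      AE_funpow[OF AE_pr_pos[OF word_measurable[OF Y_measurable, of "Suc N"]]] AE_space
  proof eventually_elim
    case (elim x)
    then obtain K where K: "\<And>n. birkhoff (info N) n x \<le> a * real n + K" by blast
    have a0: "a \<ge> 0" using a rate_nonneg by simp
    obtain n0 where n0: "real n0 > K / (c1 - a)" using reals_Archimedean2 by blast
    show ?case using eventually_ge_at_top[of n0]
    proof eventually_elim
      case (elim n)
      have "K / (c1 - a) < real n" using n0 elim by linarith
      then have "K < (c1 - a) * real n" using c1 by (simp add: field_simps)
      moreover have "a * real (n - N) \<le> a * real n" using a0 by (intro mult_left_mono) auto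
      ultimately have "birkhoff (info N) (n - N) x \<le> c1 * real n"
        using K[of "n - N"] by (simp add: algebra_simps)
      then show ?case
        using markov_weight_word[of N x n] \<open>\<forall>n. 0 < pr M (word Y N) (word Y N ((T ^^ n) x))\<close>
          \<open>\<forall>n. 0 < pr M (word Y (Suc N)) (word Y (Suc N) ((T ^^ n) x))\<close> \<open>x \<in> space M\<close>
        by (simp add: G_def word_in_words)
    qed
  qed
  define K where "K n = nat \<lfloor>exp (c * real n)\<rfloor>" for n
  define E where "E n = {x \<in> space M. word Y n x \<in> G n \<and> (\<forall>k\<in>{1..K n}. word Y n ((T ^^ k) x) \<noteq> word Y n x)}" for n
  have E[measurable]: "E n \<in> sets M" for n
  proof -
    have "E n = (\<Union>w\<in>G n. {x \<in> space M. word Y n x = w \<and> (\<forall>k\<in>{1..K n}. word Y n ((T ^^ k) x) \<noteq> w)})"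
      unfolding E_def by auto
    also have "\<dots> \<in> sets M" using Gfin by (intro sets.finite_UN) measurable
    finally show ?thesis .
  qed
  have mE: "measure M (E n) \<le> real m ^ N * exp (c1 - c) ^ n" for n
  proof -
    let ?E = "\<lambda>w. {x \<in> space M. word Y n x = w \<and> (\<forall>k\<in>{1..K n}. word Y n ((T ^^ k) x) \<noteq> w)}"
    \<comment> \<open>The floor in \<open>K\<close> loses less than 1, which the successor in
      \<open>prob_late_return\<close> restores.\<close>
    have Kn: "real (Suc (K n)) \<ge> exp (c * real n)"
      unfolding K_def using exp_ge_zero[of "c * real n"] by linarith
    have "measure M (E n) = measure M (\<Union>w\<in>G n. ?E w)"
      unfolding E_def by (intro arg_cong[where f = "measure M"]) auto
    also have "\<dots> \<le> (\<Sum>w\<in>G n. measure M (?E w))"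
    proof (intro finite_measure_subadditive_finite Gfin)
      have "?E w \<in> sets M" for w by measurable
      then show "?E ` G n \<subseteq> sets M" by blast
    qed
    also have "\<dots> \<le> (\<Sum>w\<in>G n. exp (- c * real n))"
    proof (intro sum_mono)
      fix w
      have "exp (c * real n) * measure M (?E w) \<le> real (Suc (K n)) * measure M (?E w)"
        using Kn by (intro mult_right_mono) auto
      also have "\<dots> \<le> 1" by (rule prob_late_return) measurable
      finally show "measure M (?E w) \<le> exp (- c * real n)" by (simp add: exp_minus field_simps)
    qed
    also have "\<dots> = real (card (G n)) * exp (- c * real n)" by simp
    also have "\<dots> \<le> real m ^ N * exp (c1 * real n) * exp (- c * real n)"
      by (intro mult_right_mono cardG) auto
    also have "\<dots> = real m ^ N * exp (c1 - c) ^ n"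
      by (simp add: exp_of_nat_mult[symmetric] mult_exp_exp algebra_simps)
    finally show ?thesis .
  qed
  have "summable (\<lambda>n. measure M (E n))"
  proof (rule summable_comparison_test')
    show "summable (\<lambda>n. real m ^ N * exp (c1 - c) ^ n)"
      using c1 by (intro summable_mult summable_geometric) auto
    show "norm (measure M (E n)) \<le> real m ^ N * exp (c1 - c) ^ n" if "0 \<le> n" for n using mE by simp
  qed
  then have "AE x in M. eventually (\<lambda>n. x \<in> space M - E n) sequentially"
    by (intro borel_cantelli_AE1) (auto simp: emeasure_eq_measure)
  with good show ?thesis
  proof eventually_elim
    case (elim x)
    from elim show ?case
    proof eventually_elim
      case (elim n)
      then obtain k where k: "k \<in> {1..K n}" "word Y n ((T ^^ k) x) = word Y n x" by (auto simp: E_def)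
      have "real k \<le> exp (c * real n)"
        using k(1) unfolding K_def by (auto simp: nat_le_iff le_nat_iff le_floor_iff)
      with k show ?case by auto
    qed
  qed
qed

end

section \<open>Encoding words by pointers and corrections\<close>

text \<open>There is one entry per letter. The entry 0 is no pointer, so that letter must be
  corrected; \<open>n\<close> equal entries \<open>k\<close> say that each of \<open>n\<close>
  consecutive letters is to be read \<open>k\<close> places further right. Long blocks make the
  choice of their lengths cheap, and the bound on \<open>k\<close> makes a block cost about
  \<open>b\<close> nats per letter.\<close>

inductive_set pointers :: "real \<Rightarrow> nat \<Rightarrow> nat list set" for b :: real and n0 :: nat where
  pointers_Nil: "[] \<in> pointers b n0"
| pointers_Cons: "p \<in> pointers b n0 \<Longrightarrow> 0 # p \<in> pointers b n0"
| pointers_block: "p \<in> pointers b n0 \<Longrightarrow> n0 \<le> n \<Longrightarrow> 1 \<le> k \<Longrightarrow> real k \<le> exp (b * real n) \<Longrightarrow>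
    replicate n k @ p \<in> pointers b n0"

text \<open>Splitting off the first item bounds the count for \<open>L\<close> by the count for
  \<open>L - 1\<close> plus the sum over \<open>n \<ge> n0\<close> of \<open>exp (b * n)\<close>
  times the count for \<open>L - n\<close>. With the claimed bound inserted, what remains is that
  \<open>exp (- (b + \<delta>))\<close> plus the tail of the geometric series of
  \<open>exp (- \<delta>)\<close> from \<open>n0\<close> on is at most 1. The condition on
  \<open>n0\<close> bounds this tail by \<open>1 - exp (- \<delta>)\<close>.\<close>

lemma card_pointers:
  assumes b: "b \<ge> 0" and \<delta>: "\<delta> > 0" and n0: "n0 \<ge> 1" "exp (- \<delta>) ^ n0 / (1 - exp (- \<delta>)) \<le> 1 - exp (- \<delta>)"
  shows "finite {p \<in> pointers b n0. length p = L} \<and>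
    real (card {p \<in> pointers b n0. length p = L}) \<le> exp ((b + \<delta>) * real L)"
proof (induction L rule: less_induct)
  case (less L)
  let ?P = "\<lambda>L. {p \<in> pointers b n0. length p = L}"
  let ?K = "\<lambda>n. {1..nat \<lfloor>exp (b * real n)\<rfloor>}"
  let ?q = "exp (- \<delta>)"
  show ?case
  proof (cases "L = 0")
    case True
    then have "?P L = {[]}" by (auto intro: pointers_Nil)
    then show ?thesis using True by simp
  next
    case False
    let ?B = "\<Union>n\<in>{n0..L}. (\<lambda>(k, p). replicate n k @ p) ` (?K n \<times> ?P (L - n))"
    have sub: "?P L \<subseteq> (#) 0 ` ?P (L - 1) \<union> ?B"
    proof
      fix p assume "p \<in> ?P L"
      then have p: "p \<in> pointers b n0" "length p = L" by auto
      from p(1) show "p \<in> (#) 0 ` ?P (L - 1) \<union> ?B"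
      proof cases
        case pointers_Nil
        with p False show ?thesis by simp
      next
        case (pointers_Cons p')
        with p show ?thesis by auto
      next
        case (pointers_block p' n k)
        then have "k \<in> ?K n" by (auto simp: le_nat_iff le_floor_iff)
        then have "p \<in> (\<lambda>(k, p). replicate n k @ p) ` (?K n \<times> ?P (L - n))"
          using pointers_block p by (intro image_eqI[of _ _ "(k, p')"]) auto
        moreover have "n \<in> {n0..L}" using pointers_block p by auto
        ultimately show ?thesis by blast
      qed
    qed
    have fin: "finite (?P (L - n))" and le: "real (card (?P (L - n))) \<le> exp ((b + \<delta>) * real (L - n))"
      if "n \<ge> 1" for n
      using less[of "L - n"] that False by auto
    have finB: "finite ?B" using fin n0 by (intro finite_UN_I finite_imageI finite_cartesian_product) auto
    have "real (card (?P L)) \<le> real (card ((#) 0 ` ?P (L - 1)) + card ?B)"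
      using fin[of 1] finB
      by (intro of_nat_mono order_trans[OF card_mono[OF _ sub] card_Un_le]) auto
    also have "\<dots> \<le> exp ((b + \<delta>) * real (L - 1)) + (\<Sum>n\<in>{n0..L}. exp (b * real n) * exp ((b + \<delta>) * real (L - n)))"
      unfolding of_nat_add
    proof (intro add_mono)
      show "real (card ((#) 0 ` ?P (L - 1))) \<le> exp ((b + \<delta>) * real (L - 1))"
        using le[of 1] by (subst card_image) auto
      have "real (card ?B) \<le> (\<Sum>n\<in>{n0..L}. real (card ((\<lambda>(k, p). replicate n k @ p) ` (?K n \<times> ?P (L - n)))))"
        unfolding of_nat_sum[symmetric] by (intro of_nat_mono card_UN_le) auto
      also have "\<dots> \<le> (\<Sum>n\<in>{n0..L}. exp (b * real n) * exp ((b + \<delta>) * real (L - n)))"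
      proof (intro sum_mono)
        fix n assume n: "n \<in> {n0..L}"
        have "real (card ((\<lambda>(k, p). replicate n k @ p) ` (?K n \<times> ?P (L - n)))) \<le> real (card (?K n \<times> ?P (L - n)))"
          using fin[of n] n n0 by (intro of_nat_mono card_image_le) auto
        also have "\<dots> = real (nat \<lfloor>exp (b * real n)\<rfloor>) * real (card (?P (L - n)))"
          by (simp add: card_cartesian_product)
        also have "\<dots> \<le> exp (b * real n) * exp ((b + \<delta>) * real (L - n))"
          using le[of n] n n0 by (intro mult_mono) auto
        finally show "real (card ((\<lambda>(k, p). replicate n k @ p) ` (?K n \<times> ?P (L - n))))
          \<le> exp (b * real n) * exp ((b + \<delta>) * real (L - n))" .
      qed
      finally show "real (card ?B) \<le> (\<Sum>n\<in>{n0..L}. exp (b * real n) * exp ((b + \<delta>) * real (L - n)))" .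
    qed
    also have "exp ((b + \<delta>) * real (L - 1)) = exp ((b + \<delta>) * real L) * exp (- (b + \<delta>))"
      using False by (simp add: mult_exp_exp of_nat_diff algebra_simps)
    also have "(\<Sum>n\<in>{n0..L}. exp (b * real n) * exp ((b + \<delta>) * real (L - n))) =
        exp ((b + \<delta>) * real L) * (\<Sum>n\<in>{n0..L}. ?q ^ n)"
      unfolding sum_distrib_left
      by (intro sum.cong refl) (auto simp: mult_exp_exp exp_of_nat_mult[symmetric] of_nat_diff algebra_simps)
    also have "(\<Sum>n\<in>{n0..L}. ?q ^ n) \<le> 1 - ?q"
    proof -
      have "(\<Sum>n\<in>{n0..L}. ?q ^ n) \<le> ?q ^ n0 / (1 - ?q)"
        using \<delta> by (subst sum_gp) (auto intro!: divide_right_mono)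
      with n0 show ?thesis by simp
    qed
    also have "exp ((b + \<delta>) * real L) * exp (- (b + \<delta>)) + exp ((b + \<delta>) * real L) * (1 - ?q) \<le> exp ((b + \<delta>) * real L)"
    proof -
      have "exp (- (b + \<delta>)) + (1 - ?q) \<le> 1" using b by simp
      then have "exp ((b + \<delta>) * real L) * (exp (- (b + \<delta>)) + (1 - ?q)) \<le> exp ((b + \<delta>) * real L) * 1"
        by (intro mult_left_mono) auto
      then show ?thesis by (simp add: distrib_left)
    qed
    finally have "real (card (?P L)) \<le> exp ((b + \<delta>) * real L)" by simp
    moreover have "finite (?P L)" using fin[of 1] finB by (intro finite_subset[OF sub] finite_UnI finite_imageI) auto
    ultimately show ?thesis by simp
  qed
qed

section \<open>Counting lists with few corrections\<close>

abbreviation corrected :: "'c option list \<Rightarrow> nat" where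
  "corrected d \<equiv> length (filter (\<lambda>z. z \<noteq> None) d)"

definition option_words :: "'c set \<Rightarrow> nat \<Rightarrow> 'c option list set" where
  "option_words A L = {d. set d \<subseteq> insert None (Some ` A) \<and> length d = L}"

lemma finite_option_words: "finite A \<Longrightarrow> finite (option_words A L)"
  unfolding option_words_def by (intro finite_lists_length_eq) auto

text \<open>This is the generating function of the number of corrections: each position contributes
  the factor 1 for \<open>None\<close> plus \<open>t\<close> for every possible letter.\<close>

lemma sum_option_words:
  fixes t :: real
  assumes "finite A"
  shows "(\<Sum>d\<in>option_words A L. t ^ corrected d) = (1 + real (card A) * t) ^ L"
proof (induction L)
  case 0
  have "option_words A 0 = {[]}" by (auto simp: option_words_def)
  then show ?case by simp
next
  case (Suc L)
  have eq: "option_words A (Suc L) = (\<lambda>(z, d). z # d) ` (insert None (Some ` A) \<times> option_words A L)"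
    by (auto simp: option_words_def length_Suc_conv image_iff)
  have "(\<Sum>d\<in>option_words A (Suc L). t ^ corrected d) =
      (\<Sum>(z, d)\<in>insert None (Some ` A) \<times> option_words A L. (if z = None then 1 else t) * t ^ corrected d)"
    unfolding eq by (subst sum.reindex) (auto simp: inj_on_def intro!: sum.cong)
  also have "\<dots> = (\<Sum>z\<in>insert None (Some ` A). if z = None then 1 else t) * (\<Sum>d\<in>option_words A L. t ^ corrected d)"
    by (simp add: sum.cartesian_product[symmetric] sum_product)
  also have "(\<Sum>z\<in>insert None (Some ` A). if z = None then 1 else t) = 1 + real (card A) * t"
    using assms by (subst sum.insert) (auto simp: sum.reindex)
  finally show ?case unfolding Suc power_Suc .
qed

text \<open>A Chernoff bound with weight \<open>exp (- u)\<close> per correction: \<open>u\<close>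
  is so large that the total weight is at most \<open>exp (\<delta> / 2 * L)\<close>, and
  \<open>u * \<theta> = \<delta> / 2\<close> makes every counted list weigh at least
  \<open>exp (- \<delta> / 2 * L)\<close>.\<close>

lemma card_few_corrections:
  fixes u \<theta> \<delta> :: real
  assumes A: "finite A" and u: "u > 0" "real (card A) * exp (- u) \<le> \<delta> / 2" and \<theta>: "\<theta> = \<delta> / (2 * u)"
  shows "real (card {d \<in> option_words A L. real (corrected d) \<le> \<theta> * real L}) \<le> exp (\<delta> * real L)"
proof -
  let ?T = "{d \<in> option_words A L. real (corrected d) \<le> \<theta> * real L}"
  have "real (card ?T) * exp (- u * \<theta> * real L) = (\<Sum>d\<in>?T. exp (- u * \<theta> * real L))" by simp
  also have "\<dots> \<le> (\<Sum>d\<in>?T. exp (- u) ^ corrected d)"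
  proof (intro sum_mono)
    fix d assume "d \<in> ?T"
    then have "u * real (corrected d) \<le> u * (\<theta> * real L)" using u by (intro mult_left_mono) auto
    then show "exp (- u * \<theta> * real L) \<le> exp (- u) ^ corrected d"
      by (simp add: exp_of_nat_mult[symmetric] algebra_simps)
  qed
  also have "\<dots> \<le> (\<Sum>d\<in>option_words A L. exp (- u) ^ corrected d)"
    by (intro sum_mono2 finite_option_words A) auto
  also have "\<dots> = (1 + real (card A) * exp (- u)) ^ L" by (rule sum_option_words[OF A])
  also have "\<dots> \<le> exp (real (card A) * exp (- u)) ^ L" by (intro power_mono exp_ge_add_one_self) auto
  also have "\<dots> \<le> exp (\<delta> / 2) ^ L" using u by (intro power_mono) auto
  also have "\<dots> = exp (\<delta> / 2 * real L)" by (simp add: exp_of_nat_mult[symmetric] mult.commute)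
  finally have "real (card ?T) \<le> exp (\<delta> / 2 * real L) * exp (u * \<theta> * real L)"
    by (simp add: exp_minus field_simps)
  also have "\<dots> = exp (\<delta> * real L)" using u by (simp add: \<theta> mult_exp_exp field_simps)
  finally show ?thesis .
qed

text \<open>\<open>p\<close> and \<open>d\<close> determine \<open>s\<close> from right to left: the value at \<open>j\<close> is either given
  explicitly or copied from a position further right.\<close>

definition encodes :: "nat \<Rightarrow> nat list \<Rightarrow> (nat \<times> nat) option list \<Rightarrow> (nat \<Rightarrow> nat) \<Rightarrow> (nat \<Rightarrow> nat) \<Rightarrow> bool" where
  "encodes L p d s y \<longleftrightarrow> length p = L \<and> length d = L \<and> (\<forall>j<L. d ! j = Some (s j, y j) \<or>
     d ! j = None \<and> y j = s j \<and> 1 \<le> p ! j \<and> j + p ! j < L \<and> s j = s (j + p ! j))"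

lemma encodes_unique:
  assumes e: "encodes L p d s y" "encodes L p d s' y'" and j: "j < L"
  shows "s j = s' j \<and> y j = y' j"
  using j
proof (induction "L - j" arbitrary: j rule: less_induct)
  case less
  have 1: "d ! j = Some (s j, y j) \<or> d ! j = None \<and> y j = s j \<and> 1 \<le> p ! j \<and> j + p ! j < L \<and> s j = s (j + p ! j)"
    using e(1) less.prems unfolding encodes_def by blast
  have 2: "d ! j = Some (s' j, y' j) \<or> d ! j = None \<and> y' j = s' j \<and> 1 \<le> p ! j \<and> j + p ! j < L \<and> s' j = s' (j + p ! j)"
    using e(2) less.prems unfolding encodes_def by blast
  show ?case
  proof (cases "d ! j")
    case (Some a)
    then show ?thesis using 1 2 by auto
  next
    case None
    then have 3: "y j = s j" "1 \<le> p ! j" "j + p ! j < L" "s j = s (j + p ! j)"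
      and 4: "y' j = s' j" "s' j = s' (j + p ! j)"
      using 1 2 by auto
    have "s (j + p ! j) = s' (j + p ! j)" using less.hyps[of "j + p ! j"] 3 by simp
    then show ?thesis using 3 4 by simp
  qed
qed

text \<open>Pointers of the front block may reach into the remaining letters, hence the bound
  \<open>n + L\<close> for their targets.\<close>

lemma encodes_append:
  assumes e: "encodes L p d (\<lambda>j. s (n + j)) (\<lambda>j. y (n + j))"
    and len: "length p0 = n" "length d0 = n"
    and 0: "\<And>j. j < n \<Longrightarrow> d0 ! j = Some (s j, y j) \<or>
      d0 ! j = None \<and> y j = s j \<and> 1 \<le> p0 ! j \<and> j + p0 ! j < n + L \<and> s j = s (j + p0 ! j)"
  shows "encodes (n + L) (p0 @ p) (d0 @ d) s y"
  unfolding encodes_def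
proof (intro conjI allI impI)
  fix j assume j: "j < n + L"
  show "(d0 @ d) ! j = Some (s j, y j) \<or> (d0 @ d) ! j = None \<and> y j = s j \<and> 1 \<le> (p0 @ p) ! j \<and>
     j + (p0 @ p) ! j < n + L \<and> s j = s (j + (p0 @ p) ! j)"
  proof (cases "j < n")
    case True
    then have "(d0 @ d) ! j = d0 ! j" "(p0 @ p) ! j = p0 ! j" using len by (simp_all add: nth_append)
    then show ?thesis using 0[OF True] by (simp only:)
  next
    case False
    then obtain i where i: "j = n + i" by (metis le_Suc_ex not_less)
    with j have "i < L" by simp
    have "d ! i = Some (s (n + i), y (n + i)) \<or> d ! i = None \<and> y (n + i) = s (n + i) \<and> 1 \<le> p ! i \<and>
        i + p ! i < L \<and> s (n + i) = s (n + (i + p ! i))"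
      using e \<open>i < L\<close> unfolding encodes_def by blast
    moreover have "(d0 @ d) ! j = d ! i" "(p0 @ p) ! j = p ! i" using len i by (simp_all add: nth_append)
    ultimately show ?thesis unfolding i by (auto simp only: add.assoc)
  qed
qed (use e len in \<open>simp_all add: encodes_def\<close>)

lemma card_Int_split: "card (Z \<inter> {..<n + L :: nat}) = card (Z \<inter> {..<n}) + card ({j. n + j \<in> Z} \<inter> {..<L})"
proof -
  have "{..<n + L} = {..<n} \<union> (+) n ` {..<L}"
  proof (intro set_eqI iffI)
    fix j assume "j \<in> {..<n + L}"
    then show "j \<in> {..<n} \<union> (+) n ` {..<L}"
      by (cases "j < n") (auto intro!: image_eqI[of _ _ "j - n"])
  qed auto
  then have "Z \<inter> {..<n + L} = Z \<inter> {..<n} \<union> Z \<inter> (+) n ` {..<L}" by (simp only: Int_Un_distrib)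
  also have "Z \<inter> (+) n ` {..<L} = (+) n ` ({j. n + j \<in> Z} \<inter> {..<L})" by blast
  finally have "Z \<inter> {..<n + L} = Z \<inter> {..<n} \<union> (+) n ` ({j. n + j \<in> Z} \<inter> {..<L})" .
  moreover have "card (Z \<inter> {..<n} \<union> (+) n ` ({j. n + j \<in> Z} \<inter> {..<L})) =
      card (Z \<inter> {..<n}) + card ((+) n ` ({j. n + j \<in> Z} \<inter> {..<L}))"
    by (intro card_Un_disjoint) auto
  ultimately show ?thesis by (simp add: card_image)
qed

lemma corrected_map: "corrected (map h [0..<n]) = card {j. j < n \<and> h j \<noteq> None}"
proof -
  have "corrected (map h [0..<n]) = length (filter (\<lambda>j. h j \<noteq> None) [0..<n])"
    by (simp add: filter_map comp_def)
  also have "\<dots> = card (set (filter (\<lambda>j. h j \<noteq> None) [0..<n]))"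
    by (rule distinct_card[symmetric]) simp
  also have "set (filter (\<lambda>j. h j \<noteq> None) [0..<n]) = {j. j < n \<and> h j \<noteq> None}" by auto
  finally show ?thesis .
qed

text \<open>Greedy parsing from the left, with \<open>Z\<close> the set of bad positions. A word of
  length at most \<open>R\<close> is spelled out, because a pointer might leave it. A bad first
  position takes one correction. Otherwise a block is copied, with corrections at its mismatches and
  bad positions; its pointers stay inside because \<open>n + k \<le> R < L\<close>. The three terms
  of the bound are the costs of the tail, the bad positions and the mismatches.\<close>

lemma exists_encoding:
  fixes \<theta> b :: real
  assumes n0: "n0 \<ge> 1" and \<theta>: "\<theta> \<ge> 0"
    and R: "\<And>n k. n \<le> N \<Longrightarrow> real k \<le> exp (b * real n) \<Longrightarrow> n + k \<le> R"
    and bd: "\<And>j. s j < m" "\<And>j. y j < m"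
    and good: "\<And>j. j \<notin> Z \<Longrightarrow> y j = s j"
      "\<And>j. j \<notin> Z \<Longrightarrow> \<exists>n\<in>{n0..N}. \<exists>k\<ge>1. real k \<le> exp (b * real n) \<and>
        real (card {i. i < n \<and> s (j + i) \<noteq> s (j + i + k) \<and> j + i \<notin> Z}) \<le> \<theta> * real n"
  shows "\<exists>p d. p \<in> pointers b n0 \<and> d \<in> option_words ({..<m} \<times> {..<m}) L \<and> encodes L p d s y \<and>
    real (corrected d) \<le> real R + real (card (Z \<inter> {..<L})) + \<theta> * real L"
  using bd good
proof (induction L arbitrary: s y Z rule: less_induct)
  case (less L)
  have shift: "\<exists>p d. p \<in> pointers b n0 \<and> d \<in> option_words ({..<m} \<times> {..<m}) (L - n) \<and>
      encodes (L - n) p d (\<lambda>j. s (n + j)) (\<lambda>j. y (n + j)) \<and>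
      real (corrected d) \<le> real R + real (card ({j. n + j \<in> Z} \<inter> {..<L - n})) + \<theta> * real (L - n)"
    if "n \<ge> 1" "n \<le> L" for n
  proof (rule less.IH)
    fix j assume "j \<notin> {j. n + j \<in> Z}"
    then have "n + j \<notin> Z" by simp
    from less.prems(4)[OF this] show "\<exists>n'\<in>{n0..N}. \<exists>k\<ge>1. real k \<le> exp (b * real n') \<and>
        real (card {i. i < n' \<and> s (n + (j + i)) \<noteq> s (n + (j + i + k)) \<and> j + i \<notin> {j. n + j \<in> Z}}) \<le> \<theta> * real n'"
      by (simp only: add.assoc mem_Collect_eq)
  qed (use that less.prems(1-3) in auto)
  consider "L \<le> R" | "L > R" "0 \<in> Z" | "L > R" "0 \<notin> Z" by linarith
  then show ?case
  proof cases
    case 1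
    let ?d = "map (\<lambda>j. Some (s j, y j)) [0..<L]"
    have "replicate L 0 \<in> pointers b n0"
      by (induction L) (auto intro: pointers_Nil pointers_Cons)
    moreover have "?d \<in> option_words ({..<m} \<times> {..<m}) L"
      using less.prems(1,2) by (auto simp: option_words_def)
    moreover have "encodes L (replicate L 0) ?d s y" by (auto simp: encodes_def)
    moreover have "real (corrected ?d) \<le> real R + real (card (Z \<inter> {..<L})) + \<theta> * real L"
    proof -
      have "0 \<le> real (card (Z \<inter> {..<L}))" "0 \<le> \<theta> * real L" using \<theta> by auto
      moreover have "corrected ?d = L" by (simp add: corrected_map)
      ultimately show ?thesis using 1 by linarith
    qed
    ultimately show ?thesis by blast
  next
    case 2
    obtain p d where pd: "p \<in> pointers b n0" "d \<in> option_words ({..<m} \<times> {..<m}) (L - 1)"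
      "encodes (L - 1) p d (\<lambda>j. s (1 + j)) (\<lambda>j. y (1 + j))"
      "real (corrected d) \<le> real R + real (card ({j. 1 + j \<in> Z} \<inter> {..<L - 1})) + \<theta> * real (L - 1)"
      using shift[of 1] 2 by auto
    have "encodes (1 + (L - 1)) ([0] @ p) ([Some (s 0, y 0)] @ d) s y"
      by (rule encodes_append[OF pd(3)]) auto
    then have "encodes L (0 # p) (Some (s 0, y 0) # d) s y" using 2 by simp
    moreover have "0 # p \<in> pointers b n0" using pd by (intro pointers_Cons)
    moreover have "Some (s 0, y 0) # d \<in> option_words ({..<m} \<times> {..<m}) L"
      using pd(2) less.prems(1,2) 2 by (auto simp: option_words_def)
    moreover have "real (corrected (Some (s 0, y 0) # d)) \<le> real R + real (card (Z \<inter> {..<L})) + \<theta> * real L"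
    proof -
      have "Z \<inter> {..<1} = {0}" using 2 by auto
      then have "card (Z \<inter> {..<L}) = 1 + card ({j. 1 + j \<in> Z} \<inter> {..<L - 1})"
        using card_Int_split[of Z 1 "L - 1"] 2 by simp
      moreover have "\<theta> * real (L - 1) \<le> \<theta> * real L" using \<theta> by (intro mult_left_mono) auto
      ultimately show ?thesis using pd(4) by simp
    qed
    ultimately show ?thesis by blast
  next
    case 3
    obtain n k where nk: "n \<in> {n0..N}" "k \<ge> 1" "real k \<le> exp (b * real n)"
      "real (card {i. i < n \<and> s (0 + i) \<noteq> s (0 + i + k) \<and> 0 + i \<notin> Z}) \<le> \<theta> * real n"
      using less.prems(4)[OF 3(2)] by blast
    have n: "n \<ge> 1" "n + k < L" using nk n0 3 R[of n k] by auto
    obtain p d where pd: "p \<in> pointers b n0" "d \<in> option_words ({..<m} \<times> {..<m}) (L - n)"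
      "encodes (L - n) p d (\<lambda>j. s (n + j)) (\<lambda>j. y (n + j))"
      "real (corrected d) \<le> real R + real (card ({j. n + j \<in> Z} \<inter> {..<L - n})) + \<theta> * real (L - n)"
      using shift[of n] n by auto
    \<comment> \<open>A position in \<open>Z\<close> is corrected even when \<open>s\<close> repeats
      there, since \<open>y\<close> may differ from \<open>s\<close>.\<close>
    let ?h = "\<lambda>j. if s j = s (j + k) \<and> j \<notin> Z then None else Some (s j, y j)"
    let ?d0 = "map ?h [0..<n]"
    have "encodes (n + (L - n)) (replicate n k @ p) (?d0 @ d) s y"
      by (rule encodes_append[OF pd(3)]) (use n nk(2) less.prems(3) in \<open>auto split: if_splits\<close>)
    then have "encodes L (replicate n k @ p) (?d0 @ d) s y" using n by simp
    moreover have "replicate n k @ p \<in> pointers b n0" using pd nk by (intro pointers_block) auto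
    moreover have "?d0 @ d \<in> option_words ({..<m} \<times> {..<m}) L"
      using pd(2) less.prems(1,2) n by (auto simp: option_words_def)
    moreover have "real (corrected (?d0 @ d)) \<le> real R + real (card (Z \<inter> {..<L})) + \<theta> * real L"
    proof -
      have "corrected ?d0 \<le> card ({i. i < n \<and> s (0 + i) \<noteq> s (0 + i + k) \<and> 0 + i \<notin> Z} \<union> Z \<inter> {..<n})"
        unfolding corrected_map by (intro card_mono) auto
      also have "\<dots> \<le> card {i. i < n \<and> s (0 + i) \<noteq> s (0 + i + k) \<and> 0 + i \<notin> Z} + card (Z \<inter> {..<n})"
        by (rule card_Un_le)
      finally have "real (corrected ?d0) \<le> \<theta> * real n + real (card (Z \<inter> {..<n}))" using nk(4) by linarith
      moreover have "card (Z \<inter> {..<L}) = card (Z \<inter> {..<n}) + card ({j. n + j \<in> Z} \<inter> {..<L - n})"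
        using card_Int_split[of Z n "L - n"] n by simp
      moreover have "\<theta> * real n + \<theta> * real (L - n) = \<theta> * real L"
        using n by (simp add: distrib_left[symmetric])
      ultimately show ?thesis using pd(4) by simp
    qed
    ultimately show ?thesis by blast
  qed
qed

text \<open>The code consists of what can be decoded from a pointer list and a correction list; each
  of these two choices costs one \<delta>. Of the correction budget \<theta>, one half goes to
  mismatches and the other to the tail and the bad positions. The order of the quantifiers matters:
  \<theta> must be known before \<open>S\<close> and \<open>W\<close> are chosen, whereas
  \<open>N\<close> depends on them and \<open>R\<close> on \<open>N\<close>.\<close>

lemma recurrent_words_bound:
  fixes b \<delta> :: real and m :: nat
  assumes b: "b \<ge> 0" and \<delta>: "\<delta> > 0"
  obtains n0 :: nat and \<theta> :: real where "n0 \<ge> 1" "\<theta> > 0"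
    "\<And>N. \<exists>R :: nat. \<forall>L. \<exists>G. finite G \<and> real (card G) \<le> exp ((b + 2 * \<delta>) * real L) \<and>
      (\<forall>s y Z. (\<forall>j. s j < m \<and> y j < m) \<longrightarrow>
         (\<forall>j. j \<notin> Z \<longrightarrow> y j = s j \<and> (\<exists>n\<in>{n0..N}. \<exists>k\<ge>1. real k \<le> exp (b * real n) \<and>
            real (card {i. i < n \<and> s (j + i) \<noteq> s (j + i + k) \<and> j + i \<notin> Z}) \<le> \<theta> / 2 * real n)) \<longrightarrow>
         real R + real (card (Z \<inter> {..<L})) \<le> \<theta> / 2 * real L \<longrightarrow> map y [0..<L] \<in> G)"
proof -
  let ?q = "exp (- \<delta>)" and ?A = "{..<m} \<times> {..<m}"
  have "(\<lambda>n. ?q ^ n / (1 - ?q)) \<longlonglongrightarrow> 0 / (1 - ?q)"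
    using \<delta> by (intro tendsto_divide LIMSEQ_power_zero tendsto_const) auto
  then have "eventually (\<lambda>n. ?q ^ n / (1 - ?q) < 1 - ?q) sequentially"
    by (rule order_tendstoD) (use \<delta> in auto)
  then have "eventually (\<lambda>n. ?q ^ n / (1 - ?q) < 1 - ?q \<and> n \<ge> 1) sequentially"
    using eventually_ge_at_top[of 1] by eventually_elim simp
  then obtain n0 where n0: "n0 \<ge> 1" "?q ^ n0 / (1 - ?q) < 1 - ?q"
    by (auto simp: eventually_sequentially)
  \<comment> \<open>This solves \<open>card ?A * exp (- u) \<le> \<delta> / 2\<close>. Adding 1
    keeps the argument of the logarithm positive for an empty alphabet, and the maximum makes
    \<open>u\<close> positive.\<close>
  define u where "u = max 1 (ln (real (card ?A + 1) * 2 / \<delta>))"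
  define \<theta> where "\<theta> = \<delta> / (2 * u)"
  have u: "u > 0" "real (card ?A) * exp (- u) \<le> \<delta> / 2"
  proof -
    show "u > 0" by (simp add: u_def)
    have "real (card ?A + 1) * 2 / \<delta> > 0" using \<delta> by (intro divide_pos_pos mult_pos_pos) (auto intro: add_pos_nonneg)
    then have "real (card ?A + 1) * 2 / \<delta> = exp (ln (real (card ?A + 1) * 2 / \<delta>))" by (rule exp_ln[symmetric])
    also have "\<dots> \<le> exp u" by (simp add: u_def)
    finally have "real (card ?A + 1) \<le> exp u * (\<delta> / 2)" using \<delta> by (simp add: field_simps)
    then have "real (card ?A) \<le> exp u * (\<delta> / 2)" by simp
    then show "real (card ?A) * exp (- u) \<le> \<delta> / 2" by (simp add: exp_minus field_simps)
  qed
  show thesis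
  proof (rule that)
    show "n0 \<ge> 1" by fact
    show \<theta>: "\<theta> > 0" using u \<delta> by (simp add: \<theta>_def)
    fix N :: nat
    define R where "R = N + nat \<lceil>exp (b * real N)\<rceil>"
    have R: "n + k \<le> R" if "n \<le> N" "real k \<le> exp (b * real n)" for n k
    proof -
      have "exp (b * real n) \<le> exp (b * real N)" using that b by (simp add: mult_left_mono)
      then have "real k \<le> exp (b * real N)" using that by linarith
      then have "k \<le> nat \<lceil>exp (b * real N)\<rceil>" by linarith
      then show ?thesis using that by (simp add: R_def)
    qed
    show "\<exists>R :: nat. \<forall>L. \<exists>G. finite G \<and> real (card G) \<le> exp ((b + 2 * \<delta>) * real L) \<and>
      (\<forall>s y Z. (\<forall>j. s j < m \<and> y j < m) \<longrightarrow>
         (\<forall>j. j \<notin> Z \<longrightarrow> y j = s j \<and> (\<exists>n\<in>{n0..N}. \<exists>k\<ge>1. real k \<le> exp (b * real n) \<and>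
            real (card {i. i < n \<and> s (j + i) \<noteq> s (j + i + k) \<and> j + i \<notin> Z}) \<le> \<theta> / 2 * real n)) \<longrightarrow>
         real R + real (card (Z \<inter> {..<L})) \<le> \<theta> / 2 * real L \<longrightarrow> map y [0..<L] \<in> G)"
    proof (intro exI[of _ R] allI)
      fix L :: nat
      define P where "P = {p \<in> pointers b n0. length p = L}"
      define D where "D = {d \<in> option_words ?A L. real (corrected d) \<le> \<theta> * real L}"
      \<comment> \<open>The decoder picks any word encoded by the pair;
        \<open>encodes_unique\<close> shows that there is at most one.\<close>
      define dec where "dec = (\<lambda>(p, d). SOME w. \<exists>s y. encodes L p d s y \<and> w = map y [0..<L])"
      have P: "finite P" "real (card P) \<le> exp ((b + \<delta>) * real L)"
        using card_pointers[OF b \<delta> n0(1), of L] n0(2) by (auto simp: P_def)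
      have D: "finite D" "real (card D) \<le> exp (\<delta> * real L)"
        using card_few_corrections[OF _ u \<theta>_def, of L] finite_option_words[of ?A L] by (auto simp: D_def)
      have dec: "dec (p, d) = map y [0..<L]" if "encodes L p d s y" for p d s y
      proof -
        have "\<exists>s' y'. encodes L p d s' y' \<and> dec (p, d) = map y' [0..<L]"
          unfolding dec_def prod.case by (rule someI_ex) (use that in blast)
        then show ?thesis using encodes_unique[OF that] by auto
      qed
      show "\<exists>G. finite G \<and> real (card G) \<le> exp ((b + 2 * \<delta>) * real L) \<and>
        (\<forall>s y Z. (\<forall>j. s j < m \<and> y j < m) \<longrightarrow>
         (\<forall>j. j \<notin> Z \<longrightarrow> y j = s j \<and> (\<exists>n\<in>{n0..N}. \<exists>k\<ge>1. real k \<le> exp (b * real n) \<and>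
            real (card {i. i < n \<and> s (j + i) \<noteq> s (j + i + k) \<and> j + i \<notin> Z}) \<le> \<theta> / 2 * real n)) \<longrightarrow>
         real R + real (card (Z \<inter> {..<L})) \<le> \<theta> / 2 * real L \<longrightarrow> map y [0..<L] \<in> G)"
      proof (intro exI[of _ "dec ` (P \<times> D)"] conjI allI impI)
        show "finite (dec ` (P \<times> D))" using P D by auto
        have "real (card (dec ` (P \<times> D))) \<le> real (card (P \<times> D))"
          using P D by (intro of_nat_mono card_image_le) auto
        also have "\<dots> = real (card P) * real (card D)" by (simp add: card_cartesian_product)
        also have "\<dots> \<le> exp ((b + \<delta>) * real L) * exp (\<delta> * real L)" using P D by (intro mult_mono) auto
        also have "\<dots> = exp ((b + 2 * \<delta>) * real L)" by (simp add: mult_exp_exp algebra_simps)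
        finally show "real (card (dec ` (P \<times> D))) \<le> exp ((b + 2 * \<delta>) * real L)" .
        fix s y Z
        assume 1: "\<forall>j. s j < m \<and> y j < m"
          and 2: "\<forall>j. j \<notin> Z \<longrightarrow> y j = s j \<and> (\<exists>n\<in>{n0..N}. \<exists>k\<ge>1. real k \<le> exp (b * real n) \<and>
            real (card {i. i < n \<and> s (j + i) \<noteq> s (j + i + k) \<and> j + i \<notin> Z}) \<le> \<theta> / 2 * real n)"
          and 3: "real R + real (card (Z \<inter> {..<L})) \<le> \<theta> / 2 * real L"
        have "\<exists>p d. p \<in> pointers b n0 \<and> d \<in> option_words ?A L \<and> encodes L p d s y \<and>
          real (corrected d) \<le> real R + real (card (Z \<inter> {..<L})) + \<theta> / 2 * real L"
        proof (rule exists_encoding[OF n0(1) _ R])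
          fix j assume j: "j \<notin> Z"
          show "y j = s j" using 2 j by blast
          show "\<exists>n\<in>{n0..N}. \<exists>k\<ge>1. real k \<le> exp (b * real n) \<and>
            real (card {i. i < n \<and> s (j + i) \<noteq> s (j + i + k) \<and> j + i \<notin> Z}) \<le> \<theta> / 2 * real n"
            using 2 j by blast
        qed (use 1 \<theta> in auto)
        then obtain p d where pd: "p \<in> pointers b n0" "d \<in> option_words ?A L" "encodes L p d s y"
          "real (corrected d) \<le> real R + real (card (Z \<inter> {..<L})) + \<theta> / 2 * real L" by blast
        then have "p \<in> P" "d \<in> D" using 3 by (auto simp: P_def D_def encodes_def)
        then show "map y [0..<L] \<in> dec ` (P \<times> D)"
          using dec[OF pd(3)] by (intro image_eqI[of _ _ "(p, d)"]) auto
      qed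
    qed
  qed
qed

section \<open>Approximate recurrence\<close>

lemma card_less_eq_sum: "card {i. i < n \<and> P i} = (\<Sum>i<n::nat. if P i then 1 else 0)"
  by (simp add: sum.If_cases Int_def)

lemma real_card_less_eq_sum: "real (card {i. i < n \<and> P i}) = (\<Sum>i<n::nat. if P i then 1 else 0)"
  unfolding card_less_eq_sum by (auto intro!: sum.cong)

lemma measurable_pred_eq[measurable (raw)]:
  fixes h1 h2 :: "'a \<Rightarrow> 'b::countable"
  assumes [measurable]: "h1 \<in> measurable M (count_space UNIV)" "h2 \<in> measurable M (count_space UNIV)"
  shows "Measurable.pred M (\<lambda>x. h1 x = h2 x)"
proof -
  have "(h1 x = h2 x) = (\<exists>c. h1 x = c \<and> h2 x = c)" for x by auto
  then show ?thesis by simp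
qed

context mpt
begin

text \<open>Times spent in \<open>W\<close> are exempt, because near points of \<open>W\<close>
  closeness does not determine \<open>S\<close>. They are paid for separately, through the frequency
  of visits.\<close>

definition mismatches :: "('a \<Rightarrow> nat) \<Rightarrow> 'a set \<Rightarrow> nat \<Rightarrow> nat \<Rightarrow> 'a \<Rightarrow> nat" where
  "mismatches S W n k x = card {i. i < n \<and> S ((T ^^ i) x) \<noteq> S ((T ^^ (i + k)) x) \<and> (T ^^ i) x \<notin> W}"

text \<open>Asking for every tolerance \<open>1 / (p + 1)\<close>, in the exponent and in the
  proportion of mismatches, makes the property insensitive to a shift by one step, hence invariant.
  It also keeps all quantifiers countable, hence the set measurable.\<close>

definition recurrent :: "('a \<Rightarrow> nat) \<Rightarrow> 'a set \<Rightarrow> real \<Rightarrow> 'a \<Rightarrow> bool" where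
  "recurrent S W c x \<longleftrightarrow> (\<forall>p N :: nat. \<exists>n\<ge>N. \<exists>k\<ge>1. real k \<le> exp ((c + 1 / real (Suc p)) * real n) \<and>
     real (mismatches S W n k x) \<le> 1 / real (Suc p) * real n)"

lemma mismatches_measurable[measurable]:
  assumes [measurable]: "S \<in> measurable M (count_space UNIV)" "W \<in> sets M"
  shows "(\<lambda>x. real (mismatches S W n k x)) \<in> borel_measurable M"
proof -
  have eq: "real (mismatches S W n k x) =
      (\<Sum>i<n. if S ((T ^^ i) x) \<noteq> S ((T ^^ (i + k)) x) \<and> (T ^^ i) x \<notin> W then 1 else 0)" for x
    unfolding mismatches_def real_card_less_eq_sum ..
  show ?thesis unfolding eq by measurable
qed

lemma recurrent_measurable[measurable]:
  assumes [measurable]: "S \<in> measurable M (count_space UNIV)" "W \<in> sets M"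
  shows "Measurable.pred M (recurrent S W c)"
  unfolding recurrent_def by measurable

lemma mismatches_Suc:
  "mismatches S W (Suc n) k x = (if S x \<noteq> S ((T ^^ k) x) \<and> x \<notin> W then 1 else 0) + mismatches S W n k (T x)"
  unfolding mismatches_def card_less_eq_sum
  by (simp add: sum.lessThan_Suc_shift funpow_swap1 del: sum.lessThan_Suc)

text \<open>A shift changes \<open>n\<close> by 1 and the number of mismatches by at most 1.
  Starting from half the tolerance, which is what \<open>2 * p + 1\<close> gives, both changes are
  absorbed once \<open>n\<close> is large.\<close>

lemma recurrent_T:
  assumes c: "c \<ge> 0"
  shows "recurrent S W c (T x) \<longleftrightarrow> recurrent S W c x"
proof
  assume rec: "recurrent S W c (T x)"
  show "recurrent S W c x"
    unfolding recurrent_def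
  proof (intro allI)
    fix p N :: nat
    define e where "e = 1 / real (Suc p)"
    have e: "e > 0" by (simp add: e_def)
    have e2: "1 / real (Suc (2 * p + 1)) = e / 2" by (simp add: e_def field_simps)
    \<comment> \<open>The summand \<open>2 * Suc p\<close> makes one additional mismatch at most
      \<open>e / 2 * real n\<close>.\<close>
    obtain n k where n: "n \<ge> N + 2 * Suc p" "k \<ge> 1" "real k \<le> exp ((c + e / 2) * real n)"
      "real (mismatches S W n k (T x)) \<le> e / 2 * real n"
      using rec unfolding recurrent_def e2[symmetric] by blast
    have "real (2 * Suc p) \<le> real n" using n(1) by (intro of_nat_mono) simp
    then have "1 \<le> e / 2 * real n" by (simp add: e_def field_simps)
    moreover have "mismatches S W (Suc n) k x \<le> 1 + mismatches S W n k (T x)" by (simp add: mismatches_Suc)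
    ultimately have "real (mismatches S W (Suc n) k x) \<le> e * real (Suc n)" using n(4) e by (simp add: algebra_simps)
    moreover have "(c + e / 2) * real n \<le> (c + e) * real (Suc n)" using c e by (intro mult_mono) auto
    then have "real k \<le> exp ((c + e) * real (Suc n))" using n(3) by (meson exp_le_cancel_iff order_trans)
    ultimately have "\<exists>n\<ge>N. \<exists>k\<ge>1. real k \<le> exp ((c + e) * real n) \<and> real (mismatches S W n k x) \<le> e * real n"
      using n(1,2) by (intro exI[of _ "Suc n"], intro conjI exI[of _ k]) auto
    then show "\<exists>n\<ge>N. \<exists>k\<ge>1. real k \<le> exp ((c + 1 / real (Suc p)) * real n) \<and>
      real (mismatches S W n k x) \<le> 1 / real (Suc p) * real n"
      unfolding e_def .
  qed
next
  assume rec: "recurrent S W c x"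
  show "recurrent S W c (T x)"
    unfolding recurrent_def
  proof (intro allI)
    fix p N :: nat
    define e where "e = 1 / real (Suc p)"
    have e: "e > 0" by (simp add: e_def)
    have e2: "1 / real (Suc (2 * p + 1)) = e / 2" by (simp add: e_def field_simps)
    \<comment> \<open>This is the size of \<open>n0\<close> from which
      \<open>(c + e / 2) * n0 \<le> (c + e) * (n0 - 1)\<close> holds.\<close>
    define D where "D = nat \<lceil>2 * (c + e) / e\<rceil>"
    obtain n0 k where n: "n0 \<ge> N + 2 + D" "k \<ge> 1" "real k \<le> exp ((c + e / 2) * real n0)"
      "real (mismatches S W n0 k x) \<le> e / 2 * real n0"
      using rec unfolding recurrent_def e2[symmetric] by blast
    obtain n where n0: "n0 = Suc n" using n(1) by (cases n0) auto
    have "2 * (c + e) / e \<le> real n0" using n(1) unfolding D_def by linarith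
    then have "c + e \<le> e / 2 * real n0" using e by (simp add: field_simps)
    then have "(c + e / 2) * real n0 \<le> (c + e) * real n" by (simp add: n0 field_simps)
    then have "real k \<le> exp ((c + e) * real n)" using n(3) by (meson exp_le_cancel_iff order_trans)
    moreover have "mismatches S W n k (T x) \<le> mismatches S W n0 k x" by (simp add: mismatches_Suc n0)
    moreover have "e / 2 * real n0 \<le> e * real n"
    proof -
      have "e * 1 \<le> e * real n" using n(1) n0 e by (intro mult_left_mono) auto
      then show ?thesis by (simp add: n0 algebra_simps)
    qed
    ultimately have "\<exists>n\<ge>N. \<exists>k\<ge>1. real k \<le> exp ((c + e) * real n) \<and> real (mismatches S W n k (T x)) \<le> e * real n"
      using n n0 by (intro exI[of _ n], intro conjI exI[of _ k]) auto
    then show "\<exists>n\<ge>N. \<exists>k\<ge>1. real k \<le> exp ((c + 1 / real (Suc p)) * real n) \<and>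
      real (mismatches S W n k (T x)) \<le> 1 / real (Suc p) * real n"
      unfolding e_def .
  qed
qed

text \<open>Markov's inequality: by invariance the expected number of visits before time
  \<open>L\<close> is \<open>L * measure M A\<close>. The bound is thus uniform in
  \<open>L\<close>.\<close>

lemma prob_many_visits:
  assumes [measurable]: "A \<in> sets M" and \<eta>: "\<eta> > 0" and L: "L \<ge> 1"
  shows "measure M {x \<in> space M. real (card ({j. (T ^^ j) x \<in> A} \<inter> {..<L})) \<ge> \<eta> * real L} \<le> measure M A / \<eta>"
proof -
  have card: "real (card ({j. (T ^^ j) x \<in> A} \<inter> {..<L})) = birkhoff (indicator A) L x" for x
  proof -
    have "{j. (T ^^ j) x \<in> A} \<inter> {..<L} = {j. j < L \<and> (T ^^ j) x \<in> A}" by auto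
    then show ?thesis by (simp only: real_card_less_eq_sum) (simp add: birkhoff_def indicator_def of_bool_def)
  qed
  have int: "integrable M (\<lambda>x. indicator A ((T ^^ j) x) :: real)" for j
    by (rule integrable_const_bound[of _ 1]) (auto simp: indicator_def)
  have "(\<integral>x. birkhoff (indicator A) L x \<partial>M) = (\<Sum>j<L. (\<integral>x. indicator A ((T ^^ j) x) \<partial>M))"
    unfolding birkhoff_def using int by (intro Bochner_Integration.integral_sum) auto
  also have "\<dots> = real L * measure M A"
    by (subst integral_funpow) auto
  finally have eq: "(\<integral>x. birkhoff (indicator A) L x \<partial>M) = real L * measure M A" .
  have "measure M {x \<in> space M. birkhoff (indicator A) L x \<ge> \<eta> * real L} \<le>
      (\<integral>x. birkhoff (indicator A) L x \<partial>M) / (\<eta> * real L)"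
  proof (rule integral_Markov_inequality_measure[where A = "{}"])
    show "integrable M (birkhoff (indicator A) L)"
      unfolding birkhoff_def using int by (intro Bochner_Integration.integrable_sum)
    show "AE x in M. 0 \<le> birkhoff (indicator A) L x"
      by (auto simp: birkhoff_def intro!: sum_nonneg)
  qed (use \<eta> L in auto)
  also have "\<dots> = measure M A / \<eta>" using L by (simp add: eq)
  finally show ?thesis by (simp only: card)
qed

end

context ergodic_coded_mpt
begin

text \<open>Almost sure recurrence at rate \<open>c\<close> would let one encode long \<open>Y\<close>-words with few more than
  \<open>c\<close> nats per letter. Reading off \<open>S\<close> instead of \<open>Y\<close> costs only few corrections.\<close>

lemma AE_not_recurrent:
  assumes c: "0 \<le> c" "c < rate"
  obtains \<tau> where "\<tau> > 0"
    "\<And>S W. S \<in> measurable M (count_space UNIV) \<Longrightarrow> W \<in> sets M \<Longrightarrow> (\<And>x. x \<in> space M \<Longrightarrow> S x < m) \<Longrightarrow>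
      (\<And>x. x \<in> space M \<Longrightarrow> x \<notin> W \<Longrightarrow> S x = Y x) \<Longrightarrow> measure M W < \<tau> \<Longrightarrow> AE x in M. \<not> recurrent S W c x"
proof -
  \<comment> \<open>The encoding will give \<open>rate \<le> c + 4 * \<delta>\<close>: one \<delta>
    is the tolerance in \<open>b\<close>, two come from \<open>recurrent_words_bound\<close>, and
    one from the words outside the code.\<close>
  define \<delta> where "\<delta> = (rate - c) / 6"
  have \<delta>: "\<delta> > 0" "c + 5 * \<delta> < rate" using c by (auto simp: \<delta>_def field_simps)
  define b where "b = c + \<delta>"
  have b: "b \<ge> 0" using c \<delta> by (simp add: b_def)
  obtain n0 :: nat and \<theta> :: real where n0: "n0 \<ge> 1" and \<theta>: "\<theta> > 0" and
    code: "\<And>N. \<exists>R :: nat. \<forall>L. \<exists>G. finite G \<and> real (card G) \<le> exp ((b + 2 * \<delta>) * real L) \<and>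
      (\<forall>s y Z. (\<forall>j. s j < m \<and> y j < m) \<longrightarrow>
         (\<forall>j. j \<notin> Z \<longrightarrow> y j = s j \<and> (\<exists>n\<in>{n0..N}. \<exists>k\<ge>1. real k \<le> exp (b * real n) \<and>
            real (card {i. i < n \<and> s (j + i) \<noteq> s (j + i + k) \<and> j + i \<notin> Z}) \<le> \<theta> / 2 * real n)) \<longrightarrow>
         real R + real (card (Z \<inter> {..<L})) \<le> \<theta> / 2 * real L \<longrightarrow> map y [0..<L] \<in> G)"
    using recurrent_words_bound[OF b \<delta>(1), of m] by blast
  have m1: "real m \<ge> 1" using m_pos by simp
  \<comment> \<open>This is the admissible probability of words outside the code. The added 1 avoids
    division by 0 for a one-letter alphabet.\<close>
  define \<rho> where "\<rho> = \<delta> / (ln (real m) + 1)"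
  have ln_m: "0 \<le> ln (real m)" by (rule ln_ge_zero[OF m1])
  have \<rho>: "\<rho> > 0" "\<rho> * ln (real m) \<le> \<delta>"
  proof -
    show "\<rho> > 0" unfolding \<rho>_def using \<delta>(1) ln_m by (intro divide_pos_pos) linarith+
    then have "\<rho> * ln (real m) \<le> \<rho> * (ln (real m) + 1)" by simp
    also have "\<dots> = \<delta>" using ln_m by (simp add: \<rho>_def)
    finally show "\<rho> * ln (real m) \<le> \<delta>" .
  qed
  \<comment> \<open>The bad set \<open>A\<close> below has measure at most
    \<open>2 * \<tau>\<close>, and \<open>prob_many_visits\<close> with threshold
    \<open>\<theta> / 4\<close> turns this into \<rho>.\<close>
  define \<tau> where "\<tau> = \<rho> * \<theta> / 8"
  have \<tau>: "\<tau> > 0" using \<rho> \<theta> by (simp add: \<tau>_def)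
  show thesis
  proof (rule that[OF \<tau>])
    fix S :: "'a \<Rightarrow> nat" and W :: "'a set"
    assume [measurable]: "S \<in> measurable M (count_space UNIV)" "W \<in> sets M"
    assume S: "\<And>x. x \<in> space M \<Longrightarrow> S x < m" "\<And>x. x \<in> space M \<Longrightarrow> x \<notin> W \<Longrightarrow> S x = Y x"
      and W: "measure M W < \<tau>"
    define B where "B = {x \<in> space M. recurrent S W c x}"
    have [measurable]: "B \<in> sets M" unfolding B_def by measurable
    have "T -` B \<inter> space M = B"
      using recurrent_T[OF c(1), of S W] measurable_space[OF T_measurable] by (auto simp: B_def)
    then consider "prob B = 0" | "prob B = 1" using ergodic[of B] by auto
    then have "prob B = 0"
    proof cases
      case 2
      \<comment> \<open>Bounding the block length by \<open>N\<close> is what makes a finite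
        \<open>R\<close> available. Almost every point is good for some \<open>N\<close>, so one
        \<open>N\<close> serves all but a set of measure less than \<tau>.\<close>
      define good where "good N x \<longleftrightarrow> (\<exists>n\<in>{n0..N}. \<exists>k\<ge>1. real k \<le> exp (b * real n) \<and>
        real (mismatches S W n k x) \<le> \<theta> / 2 * real n)" for N x
      have good_meas[measurable]: "Measurable.pred M (good N)" for N unfolding good_def by measurable
      have "\<exists>N. good N x" if "x \<in> B" for x
      proof -
        define q where "q = min \<delta> (\<theta> / 2)"
        have q: "0 < q" using \<delta> \<theta> by (simp add: q_def)
        obtain p :: nat where p: "1 / q < real p" using reals_Archimedean2 by blast
        then have "1 / real (Suc p) \<le> q" using q by (simp add: field_simps)
        then have p: "1 / real (Suc p) \<le> \<delta>" "1 / real (Suc p) \<le> \<theta> / 2" by (auto simp: q_def)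
        obtain n k where n: "n \<ge> n0" "k \<ge> 1" "real k \<le> exp ((c + 1 / real (Suc p)) * real n)"
          "real (mismatches S W n k x) \<le> 1 / real (Suc p) * real n"
          using \<open>x \<in> B\<close> unfolding B_def recurrent_def by blast
        have "(c + 1 / real (Suc p)) * real n \<le> b * real n"
          using p by (intro mult_right_mono) (auto simp: b_def)
        then have "real k \<le> exp (b * real n)" using n(3) by (meson exp_le_cancel_iff order_trans)
        moreover have "1 / real (Suc p) * real n \<le> \<theta> / 2 * real n" using p(2) by (rule mult_right_mono) simp
        then have "real (mismatches S W n k x) \<le> \<theta> / 2 * real n" using n(4) by linarith
        ultimately have "good n x"
          using n unfolding good_def by (intro bexI[of _ n] exI[of _ k]) auto
        then show ?thesis ..
      qed
      then have "B \<subseteq> (\<Union>N. {x \<in> space M. good N x})" by (auto simp: B_def)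
      then have "1 \<le> prob (\<Union>N. {x \<in> space M. good N x})"
        using 2 finite_measure_mono[of B "\<Union>N. {x \<in> space M. good N x}"] by auto
      then have one: "prob (\<Union>N. {x \<in> space M. good N x}) = 1" by (simp add: antisym)
      have "(\<lambda>N. prob {x \<in> space M. good N x}) \<longlonglongrightarrow> prob (\<Union>N. {x \<in> space M. good N x})"
      proof (rule finite_Lim_measure_incseq)
        have "{x \<in> space M. good N x} \<in> sets M" for N by measurable
        then show "range (\<lambda>N. {x \<in> space M. good N x}) \<subseteq> sets M" by blast
        show "incseq (\<lambda>N. {x \<in> space M. good N x})" by (force simp: incseq_def good_def)
      qed
      then have "eventually (\<lambda>N. prob {x \<in> space M. good N x} > 1 - \<tau>) sequentially"
        unfolding one by (rule order_tendstoD) (use \<tau> in auto)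
      then obtain N where N: "prob {x \<in> space M. good N x} > 1 - \<tau>" by (auto simp: eventually_sequentially)
      define A where "A = W \<union> {x \<in> space M. \<not> good N x}"
      have [measurable]: "A \<in> sets M" unfolding A_def by measurable
      have "prob A \<le> prob W + prob {x \<in> space M. \<not> good N x}"
        unfolding A_def by (rule measure_Un_le) measurable
      also have "prob {x \<in> space M. \<not> good N x} = 1 - prob {x \<in> space M. good N x}"
        by (rule prob_neg) measurable
      finally have "prob A \<le> 2 * \<tau>" using N W by simp
      then have A: "prob A / (\<theta> / 4) \<le> \<rho>" using \<theta> by (simp add: \<tau>_def field_simps)
      obtain R :: nat where R: "\<forall>L. \<exists>G. finite G \<and> real (card G) \<le> exp ((b + 2 * \<delta>) * real L) \<and>
        (\<forall>s y Z. (\<forall>j. s j < m \<and> y j < m) \<longrightarrow>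
         (\<forall>j. j \<notin> Z \<longrightarrow> y j = s j \<and> (\<exists>n\<in>{n0..N}. \<exists>k\<ge>1. real k \<le> exp (b * real n) \<and>
            real (card {i. i < n \<and> s (j + i) \<noteq> s (j + i + k) \<and> j + i \<notin> Z}) \<le> \<theta> / 2 * real n)) \<longrightarrow>
         real R + real (card (Z \<inter> {..<L})) \<le> \<theta> / 2 * real L \<longrightarrow> map y [0..<L] \<in> G)"
        using code[of N] by blast
      \<comment> \<open>From \<open>L0\<close> on, \<open>R\<close> uses at most half of the budget
        \<open>\<theta> / 2 * L\<close>; the other half is for visits to \<open>A\<close>.\<close>
      obtain L0 :: nat where L0: "4 * real R / \<theta> < real L0" using reals_Archimedean2 by blast
      have ent_le: "ent M (word Y L) \<le> ln 2 + (c + 4 * \<delta>) * real L" if L: "L \<ge> max L0 1" for L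
      proof -
        have RL: "real R \<le> \<theta> / 4 * real L"
        proof -
          have "4 * real R / \<theta> < real L" using L0 L by linarith
          then show ?thesis using \<theta> by (simp add: field_simps)
        qed
        obtain G where G: "finite G" "real (card G) \<le> exp ((b + 2 * \<delta>) * real L)" and
          mem: "\<And>s y Z. \<forall>j. s j < m \<and> y j < m \<Longrightarrow>
           (\<forall>j. j \<notin> Z \<longrightarrow> y j = s j \<and> (\<exists>n\<in>{n0..N}. \<exists>k\<ge>1. real k \<le> exp (b * real n) \<and>
              real (card {i. i < n \<and> s (j + i) \<noteq> s (j + i + k) \<and> j + i \<notin> Z}) \<le> \<theta> / 2 * real n)) \<Longrightarrow>
           real R + real (card (Z \<inter> {..<L})) \<le> \<theta> / 2 * real L \<Longrightarrow> map y [0..<L] \<in> G"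
          using spec[OF R, of L] by blast
        have inG: "word Y L x \<in> G"
          if x: "x \<in> space M" and few: "real (card ({j. (T ^^ j) x \<in> A} \<inter> {..<L})) < \<theta> / 4 * real L" for x
          unfolding word_def
        proof (rule mem[of "\<lambda>i. S ((T ^^ i) x)" _ "{j. (T ^^ j) x \<in> A}"])
          show "\<forall>j. S ((T ^^ j) x) < m \<and> Y ((T ^^ j) x) < m" using x S Y_less funpow_space by auto
          show "real R + real (card ({j. (T ^^ j) x \<in> A} \<inter> {..<L})) \<le> \<theta> / 2 * real L" using RL few by simp
          show "\<forall>j. j \<notin> {j. (T ^^ j) x \<in> A} \<longrightarrow> Y ((T ^^ j) x) = S ((T ^^ j) x) \<and>
            (\<exists>n\<in>{n0..N}. \<exists>k\<ge>1. real k \<le> exp (b * real n) \<and>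
              real (card {i. i < n \<and> S ((T ^^ (j + i)) x) \<noteq> S ((T ^^ (j + i + k)) x) \<and>
                j + i \<notin> {j. (T ^^ j) x \<in> A}}) \<le> \<theta> / 2 * real n)"
          proof (intro allI impI conjI)
            fix j assume "j \<notin> {j. (T ^^ j) x \<in> A}"
            then have j: "(T ^^ j) x \<notin> W" "good N ((T ^^ j) x)" using funpow_space[OF x] by (auto simp: A_def)
            show "Y ((T ^^ j) x) = S ((T ^^ j) x)" using S(2) j funpow_space[OF x] by simp
            obtain n k where n: "n \<in> {n0..N}" "k \<ge> 1" "real k \<le> exp (b * real n)"
              "real (mismatches S W n k ((T ^^ j) x)) \<le> \<theta> / 2 * real n"
              using j(2) unfolding good_def by blast
            have T_add: "(T ^^ i) ((T ^^ j) x) = (T ^^ (j + i)) x" for i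
              by (simp add: funpow_add add.commute[of j i])
            \<comment> \<open>\<open>A\<close> contains \<open>W\<close>, so exempting the visits to
              \<open>A\<close> only lowers the count.\<close>
            have "card {i. i < n \<and> S ((T ^^ (j + i)) x) \<noteq> S ((T ^^ (j + i + k)) x) \<and> j + i \<notin> {j. (T ^^ j) x \<in> A}}
              \<le> mismatches S W n k ((T ^^ j) x)"
              unfolding mismatches_def T_add by (intro card_mono) (auto simp: A_def add.assoc)
            then have "real (card {i. i < n \<and> S ((T ^^ (j + i)) x) \<noteq> S ((T ^^ (j + i + k)) x) \<and>
                j + i \<notin> {j. (T ^^ j) x \<in> A}}) \<le> \<theta> / 2 * real n" using n(4) by linarith
            then show "\<exists>n\<in>{n0..N}. \<exists>k\<ge>1. real k \<le> exp (b * real n) \<and>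
              real (card {i. i < n \<and> S ((T ^^ (j + i)) x) \<noteq> S ((T ^^ (j + i + k)) x) \<and>
                j + i \<notin> {j. (T ^^ j) x \<in> A}}) \<le> \<theta> / 2 * real n" using n by blast
          qed
        qed
        have "prob {x \<in> space M. word Y L x \<notin> G} \<le>
            prob {x \<in> space M. real (card ({j. (T ^^ j) x \<in> A} \<inter> {..<L})) \<ge> \<theta> / 4 * real L}"
        proof (rule finite_measure_mono)
          show "{x \<in> space M. word Y L x \<notin> G} \<subseteq>
            {x \<in> space M. real (card ({j. (T ^^ j) x \<in> A} \<inter> {..<L})) \<ge> \<theta> / 4 * real L}"
            using inG by (auto simp: not_le[symmetric])
          have "real (card ({j. (T ^^ j) x \<in> A} \<inter> {..<L})) = (\<Sum>j<L. indicator A ((T ^^ j) x))" for x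
          proof -
            have "{j. (T ^^ j) x \<in> A} \<inter> {..<L} = {j. j < L \<and> (T ^^ j) x \<in> A}" by auto
            then show ?thesis by (simp only: real_card_less_eq_sum) (simp add: indicator_def of_bool_def)
          qed
          then show "{x \<in> space M. real (card ({j. (T ^^ j) x \<in> A} \<inter> {..<L})) \<ge> \<theta> / 4 * real L} \<in> sets M"
            by simp
        qed
        also have "\<dots> \<le> \<rho>" using prob_many_visits[of A "\<theta> / 4" L] A \<theta> L by simp
        finally have "ent M (word Y L) \<le> ln 2 + ln (exp ((b + 2 * \<delta>) * real L)) + \<rho> * ln (real m ^ L)"
          using G b \<delta> m1 word_in_words
          by (intro ent_le_card[where W = "words m L" and G = G]) (auto simp: card_words)
        also have "\<dots> = ln 2 + (b + 2 * \<delta>) * real L + \<rho> * ln (real m) * real L"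
          using m1 by (simp add: ln_realpow)
        also have "\<dots> \<le> ln 2 + (b + 2 * \<delta>) * real L + \<delta> * real L"
          using \<rho> by (intro add_left_mono mult_right_mono) auto
        also have "\<dots> = ln 2 + (c + 4 * \<delta>) * real L" by (simp add: b_def algebra_simps)
        finally show ?thesis .
      qed
      have "rate \<le> c + 4 * \<delta>"
      proof (rule LIMSEQ_le[OF ent_word_tendsto])
        show "(\<lambda>L. ln 2 / real L + (c + 4 * \<delta>)) \<longlonglongrightarrow> c + 4 * \<delta>" by real_asymp
        show "\<exists>L1. \<forall>L\<ge>L1. ent M (word Y L) / real L \<le> ln 2 / real L + (c + 4 * \<delta>)"
        proof (intro exI[of _ "max L0 1"] allI impI)
          fix L assume L: "max L0 1 \<le> L"
          show "ent M (word Y L) / real L \<le> ln 2 / real L + (c + 4 * \<delta>)"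
            using ent_le[OF L] L by (simp add: field_simps)
        qed
      qed
      with \<delta> show ?thesis by simp
    qed
    then have "AE x in M. x \<notin> B" by (simp add: prob_eq_0)
    then show "AE x in M. \<not> recurrent S W c x" using AE_space by eventually_elim (auto simp: B_def)
  qed
qed

end

section \<open>Codings and finite partitions\<close>

definition fibres :: "'a measure \<Rightarrow> ('a \<Rightarrow> 'c) \<Rightarrow> 'a set set" where
  "fibres M Z = (\<lambda>w. {x \<in> space M. Z x = w}) ` Z ` space M"

lemma in_fibres: "A \<in> fibres M Z \<Longrightarrow> x \<in> A \<Longrightarrow> A = {y \<in> space M. Z y = Z x}"
  by (auto simp: fibres_def)

lemma fibres_member: "x \<in> space M \<Longrightarrow> {y \<in> space M. Z y = Z x} \<in> fibres M Z"
  by (auto simp: fibres_def)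

lemma inj_on_fibres: "inj_on (\<lambda>w. {x \<in> space M. Z x = w}) (Z ` space M)"
  by (auto simp: inj_on_def)

text \<open>If blocks chosen from the partitions all contain \<open>x\<close>, they are the fibres
  through \<open>x\<close>, so their intersection is the joint fibre. The case \<open>n = 0\<close>
  is excluded because an empty intersection is the whole type instead of
  \<open>space M\<close>.\<close>

lemma common_refinement_fibres:
  assumes "n \<ge> 1"
  shows "common_refinement ((\<lambda>i. fibres M (Z i)) ` {0..<n}) = fibres M (\<lambda>x. map (\<lambda>i. Z i x) [0..<n])"
    (is "common_refinement ?P = fibres M ?w")
proof (intro set_eqI iffI)
  have block: "\<Inter> (F ` ?P) = {y \<in> space M. ?w y = ?w x}"
    if F: "\<And>B. B \<in> ?P \<Longrightarrow> F B \<in> B \<and> x \<in> F B" for F x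
  proof -
    have "F (fibres M (Z i)) = {y \<in> space M. Z i y = Z i x}" if "i < n" for i
      using F[of "fibres M (Z i)"] that by (intro in_fibres) auto
    then have "\<Inter> (F ` ?P) = (\<Inter>i\<in>{0..<n}. {y \<in> space M. Z i y = Z i x})" by auto
    also have "\<dots> = {y \<in> space M. ?w y = ?w x}" using assms by force
    finally show ?thesis .
  qed
  {
    fix A assume "A \<in> common_refinement ?P"
    then obtain F x where F: "F \<in> (\<Pi> B\<in>?P. B)" "A = \<Inter> (F ` ?P)" "x \<in> A"
      unfolding common_refinement by blast
    then have "A = {y \<in> space M. ?w y = ?w x}" by (simp only:) (rule block, auto)
    moreover from this F(3) have "x \<in> space M" by blast
    ultimately show "A \<in> fibres M ?w" using fibres_member[of x M ?w] by simp
  next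
    fix A assume "A \<in> fibres M ?w"
    then obtain x where x: "x \<in> space M" "A = {y \<in> space M. ?w y = ?w x}" unfolding fibres_def by blast
    define F where "F B = (SOME C. C \<in> B \<and> x \<in> C)" for B
    have F: "F B \<in> B \<and> x \<in> F B" if "B \<in> ?P" for B
      unfolding F_def by (rule someI_ex) (use that x(1) fibres_member in fastforce)
    have "A = \<Inter> (F ` ?P)" unfolding x(2) by (rule block[OF F, symmetric])
    moreover have "x \<in> A" using x by simp
    ultimately show "A \<in> common_refinement ?P" unfolding common_refinement using F by blast
  }
qed

context mpt
begin

lemma preimage_partition_fibres: "preimage_partition M T i (fibres M Y) = fibres M (\<lambda>x. Y ((T ^^ i) x))"
proof (intro set_eqI iffI)
  fix A assume "A \<in> preimage_partition M T i (fibres M Y)"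
  then obtain x y where "A = (T ^^ i) -` {z \<in> space M. Y z = Y y} \<inter> space M" "x \<in> A"
    unfolding preimage_partition_def fibres_def by blast
  then have "A = {z \<in> space M. Y ((T ^^ i) z) = Y ((T ^^ i) x)}" "x \<in> space M" using funpow_space by auto
  then show "A \<in> fibres M (\<lambda>x. Y ((T ^^ i) x))" using fibres_member[of x M "\<lambda>x. Y ((T ^^ i) x)"] by simp
next
  fix A assume "A \<in> fibres M (\<lambda>x. Y ((T ^^ i) x))"
  then obtain x where x: "x \<in> space M" "A = {z \<in> space M. Y ((T ^^ i) z) = Y ((T ^^ i) x)}"
    unfolding fibres_def by blast
  then have "A = (T ^^ i) -` {z \<in> space M. Y z = Y ((T ^^ i) x)} \<inter> space M" using funpow_space by auto
  moreover have "A \<noteq> {}" using x by auto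
  ultimately show "A \<in> preimage_partition M T i (fibres M Y)"
    unfolding preimage_partition_def using fibres_member[OF funpow_space[OF x(1), of i], of Y] by blast
qed

lemma iterated_partition_fibres:
  assumes "n \<ge> 1"
  shows "iterated_partition M T n (fibres M Y) = fibres M (word Y n)"
  unfolding iterated_partition_def preimage_partition_fibres
  using common_refinement_fibres[OF assms, of M "\<lambda>i x. Y ((T ^^ i) x)"]
  by (simp add: word_def[abs_def])

end

lemma (in prob_space) partition_entropy_fibres:
  fixes Z :: "'a \<Rightarrow> 'c::countable"
  assumes "Z \<in> measurable M (count_space UNIV)" "finite (Z ` space M)"
  shows "partition_entropy M (fibres M Z) = ent M Z"
  using assms ent_sum[of Z "Z ` space M"]
  by (simp add: partition_entropy_def fibres_def sum.reindex[OF inj_on_fibres] pr_def)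

context coded_mpt
begin

lemma entropy_wrt_fibres: "entropy_wrt_partition M T (fibres M Y) = rate"
  unfolding entropy_wrt_partition_def
proof (rule limI)
  have "finite (word Y n ` space M)" for n
    by (rule finite_subset[OF _ finite_words[of m n]]) (auto intro: word_in_words)
  then have "1 / real n * partition_entropy M (iterated_partition M T n (fibres M Y)) = ent M (word Y n) / real n"
    if "n \<ge> 1" for n
    using that by (simp add: iterated_partition_fibres partition_entropy_fibres)
  then have "eventually (\<lambda>n. ent M (word Y n) / real n =
      1 / real n * partition_entropy M (iterated_partition M T n (fibres M Y))) sequentially"
    by (intro eventually_mono[OF eventually_ge_at_top[of 1]]) simp
  then show "(\<lambda>n. 1 / real n * partition_entropy M (iterated_partition M T n (fibres M Y))) \<longlonglongrightarrow> rate"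
    using ent_word_tendsto by (rule Lim_transform_eventually[rotated])
qed

lemma finite_measurable_partition_fibres: "finite_measurable_partition M (fibres M Y)"
  unfolding finite_measurable_partition_def
proof (intro conjI)
  have "finite (Y ` space M)" by (rule finite_subset[of _ "{..<m}"]) (auto intro: Y_less)
  then show "finite (fibres M Y)" by (simp add: fibres_def)
  show "fibres M Y \<subseteq> sets M" by (auto simp: fibres_def)
  show "partition_on (space M) (fibres M Y)"
    by (auto simp: partition_on_def disjoint_def fibres_def)
qed

lemma rate_le_measure_entropy: "ereal rate \<le> measure_entropy M T"
  unfolding measure_entropy_def using finite_measurable_partition_fibres
  by (auto simp: entropy_wrt_fibres[symmetric] intro!: SUP_upper)

end

lemma (in prob_space) finite_measurable_partition_code:
  assumes \<xi>: "finite_measurable_partition M \<xi>"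
  obtains Y :: "'a \<Rightarrow> nat" and m where "Y \<in> measurable M (count_space UNIV)"
    "\<And>x. x \<in> space M \<Longrightarrow> Y x < m" "fibres M Y = \<xi>"
proof -
  have fin: "finite \<xi>" and meas: "\<xi> \<subseteq> sets M" and part: "partition_on (space M) \<xi>"
    using \<xi> by (auto simp: finite_measurable_partition_def)
  obtain e :: "'a set \<Rightarrow> nat" where e: "bij_betw e \<xi> {0..<card \<xi>}"
    using ex_bij_betw_finite_nat[OF fin] by blast
  define Y where "Y x = e (THE A. A \<in> \<xi> \<and> x \<in> A)" for x
  have Y: "Y x = e A" if "A \<in> \<xi>" "x \<in> A" for x A
  proof -
    have "(THE A. A \<in> \<xi> \<and> x \<in> A) = A"
      using part that by (intro the_equality) (auto simp: partition_on_def disjoint_def)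
    then show ?thesis by (simp add: Y_def)
  qed
  have cover: "\<exists>A\<in>\<xi>. x \<in> A" if "x \<in> space M" for x using part that by (auto simp: partition_on_def)
  have sub: "A \<subseteq> space M" if "A \<in> \<xi>" for A using part that by (auto simp: partition_on_def)
  have block: "{x \<in> space M. Y x = e A} = A" if "A \<in> \<xi>" for A
  proof (intro set_eqI iffI)
    fix x assume x: "x \<in> {x \<in> space M. Y x = e A}"
    then obtain B where B: "B \<in> \<xi>" "x \<in> B" using cover by blast
    then have "e B = e A" using x Y[OF B] by simp
    then show "x \<in> A" using e B that by (auto simp: bij_betw_def dest: inj_onD)
  qed (use that Y sub in auto)
  show thesis
  proof (rule that)
    show "Y x < card \<xi>" if "x \<in> space M" for x
      using cover[OF that] Y e by (auto simp: bij_betw_def)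
    show "fibres M Y = \<xi>"
    proof (intro set_eqI iffI)
      fix A assume "A \<in> fibres M Y"
      then obtain x where x: "x \<in> space M" "A = {y \<in> space M. Y y = Y x}" by (auto simp: fibres_def)
      then obtain B where "B \<in> \<xi>" "x \<in> B" using cover by blast
      then show "A \<in> \<xi>" using x block Y by simp
    next
      fix A assume A: "A \<in> \<xi>"
      then have "A \<noteq> {}" using part by (auto simp: partition_on_def)
      then obtain x where "x \<in> A" by blast
      then show "A \<in> fibres M Y" using A block[OF A] Y[OF A] sub[OF A] fibres_member[of x M Y] by auto
    qed
    have "Y -` {k} \<inter> space M \<in> sets M" for k
    proof (cases "\<exists>A\<in>\<xi>. k = e A")
      case True
      then obtain A where "A \<in> \<xi>" "k = e A" by blast
      then have "Y -` {k} \<inter> space M = A" using block[of A] by auto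
      then show ?thesis using \<open>A \<in> \<xi>\<close> meas by auto
    next
      case False
      then have "Y -` {k} \<inter> space M = {}" using cover Y by fastforce
      then show ?thesis by simp
    qed
    then show "Y \<in> measurable M (count_space UNIV)"
      by (simp add: measurable_count_space_eq2_countable)
  qed
qed

section \<open>Codings of compact metric spaces\<close>

text \<open>The library proves regularity only for Polish spaces, whereas here the ambient metric
  space need be neither complete nor separable.\<close>

lemma borel_closed_open_approx:
  fixes M :: "'a::metric_space measure"
  assumes "finite_measure M" and sets: "sets M = sets borel" and B: "B \<in> sets borel" and "e > 0"
  shows "\<exists>C U. closed C \<and> open U \<and> C \<subseteq> B \<and> B \<subseteq> U \<and> measure M (U - C) < e"
proof -
  interpret finite_measure M by fact
  have "B \<in> sigma_sets UNIV (Collect closed)"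
    using B by (simp add: borel_eq_closed)
  then show ?thesis using \<open>e > 0\<close>
  proof (induction B arbitrary: e)
    case (Basic C)
    then have C: "closed C" by simp
    \<comment> \<open>These open neighbourhoods decrease to the closure of \<open>C\<close>, which
      is \<open>C\<close> itself.\<close>
    let ?U = "\<lambda>n. \<Union>x\<in>C. ball x (1 / real (Suc n))"
    have "(\<lambda>n. measure M (?U n - C)) \<longlonglongrightarrow> measure M (\<Inter>n. ?U n - C)"
    proof (rule finite_Lim_measure_decseq)
      show "range (\<lambda>n. ?U n - C) \<subseteq> sets M" using C unfolding sets by (intro image_subsetI sets.Diff borel_open borel_closed open_UN ballI open_ball)
      show "decseq (\<lambda>n. ?U n - C)"
        unfolding decseq_def
      proof (intro allI impI Diff_mono UN_mono)
        fix i j :: nat assume "i \<le> j"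
        then show "ball x (1 / real (Suc j)) \<subseteq> ball x (1 / real (Suc i))" for x :: 'a
          by (intro subset_ball) (simp add: frac_le)
      qed auto
    qed
    also have "(\<Inter>n. ?U n - C) = {}"
    proof -
      have "y \<in> C" if y: "\<And>n. y \<in> ?U n" for y
      proof -
        have "y \<in> closure C"
          unfolding closure_approachable
        proof (intro allI impI)
          fix e :: real assume "e > 0"
          then obtain n where n: "1 / real (Suc n) < e" by (rule nat_approx_posE)
          obtain x where "x \<in> C" "dist x y < 1 / real (Suc n)" using y[of n] by auto
          then show "\<exists>x\<in>C. dist x y < e" using n by force
        qed
        then show ?thesis using C by simp
      qed
      then show ?thesis by blast
    qed
    finally have "eventually (\<lambda>n. measure M (?U n - C) < e) sequentially"
      using Basic(2) by (intro order_tendstoD) auto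
    then obtain n where n: "measure M (?U n - C) < e" by (auto simp: eventually_sequentially)
    have sub: "C \<subseteq> ?U n"
    proof
      fix x assume "x \<in> C"
      moreover have "x \<in> ball x (1 / real (Suc n))" by simp
      ultimately show "x \<in> ?U n" by blast
    qed
    show ?case
      by (intro exI[of _ C] exI[of _ "?U n"] conjI C sub n open_UN ballI open_ball subset_refl)
  next
    case Empty
    then have "measure M ({} - {}) < e" by simp
    then show ?case by blast
  next
    case (Compl B)
    obtain C U where CU: "closed C" "open U" "C \<subseteq> B" "B \<subseteq> U" "measure M (U - C) < e"
      using Compl.IH[OF Compl.prems] by (elim exE conjE)
    have "- C - - U = U - C" by auto
    then have "measure M (- C - - U) < e" using CU(5) by simp
    moreover have "closed (- U)" "open (- C)" "- U \<subseteq> UNIV - B" "UNIV - B \<subseteq> - C" using CU by auto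
    ultimately show ?case by (intro exI[of _ "- U"] exI[of _ "- C"] conjI)
  next
    case (Union A)
    have "\<exists>C U. closed C \<and> open U \<and> C \<subseteq> A i \<and> A i \<subseteq> U \<and> measure M (U - C) < e / 2 * (1 / 2) ^ Suc i" for i
      using Union.IH[of "e / 2 * (1 / 2) ^ Suc i" i] Union.prems by simp
    then have "\<forall>i. \<exists>C U. closed C \<and> open U \<and> C \<subseteq> A i \<and> A i \<subseteq> U \<and> measure M (U - C) < e / 2 * (1 / 2) ^ Suc i" ..
    from choice[OF this] obtain C where "\<forall>i. \<exists>U. closed (C i) \<and> open U \<and> C i \<subseteq> A i \<and> A i \<subseteq> U \<and>
      measure M (U - C i) < e / 2 * (1 / 2) ^ Suc i" ..
    from choice[OF this] obtain U where "\<forall>i. closed (C i) \<and> open (U i) \<and> C i \<subseteq> A i \<and> A i \<subseteq> U i \<and>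
      measure M (U i - C i) < e / 2 * (1 / 2) ^ Suc i" ..
    then have CU: "\<And>i. closed (C i)" "\<And>i. open (U i)" "\<And>i. C i \<subseteq> A i" "\<And>i. A i \<subseteq> U i"
      "\<And>i. measure M (U i - C i) < e / 2 * (1 / 2) ^ Suc i" by simp_all
    have meas[measurable]: "C i \<in> sets M" "U i \<in> sets M" for i using CU sets by auto
    have geo: "(\<lambda>i. e / 2 * (1 / 2) ^ Suc i) sums (e / 2 * 1)"
      by (intro sums_mult power_half_series)
    have summ: "summable (\<lambda>i. measure M (U i - C i))"
      by (rule summable_comparison_test'[OF sums_summable[OF geo]]) (simp only: real_norm_def abs_of_nonneg[OF measure_nonneg] less_imp_le[OF CU(5)])
    have "measure M ((\<Union>i. U i) - (\<Union>i. C i)) \<le> measure M (\<Union>i. U i - C i)"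
      by (intro finite_measure_mono) auto
    also have "\<dots> \<le> (\<Sum>i. measure M (U i - C i))"
      by (intro finite_measure_subadditive_countably summ) auto
    also have "\<dots> \<le> e / 2"
      using suminf_le[OF less_imp_le[OF CU(5)] summ sums_summable[OF geo]] sums_unique[OF geo] by simp
    finally have 1: "measure M ((\<Union>i. U i) - (\<Union>i. C i)) \<le> e / 2" .
    \<comment> \<open>The union of all \<open>C i\<close> need not be closed, so it is cut off after
      finitely many; the gaps between \<open>U i\<close> and \<open>C i\<close> were summed to only
      \<open>e / 2\<close> to leave room for this.\<close>
    let ?D = "\<lambda>n. (\<Union>i. C i) - (\<Union>i\<in>{..n}. C i)"
    have "(\<lambda>n. measure M (?D n)) \<longlonglongrightarrow> measure M (\<Inter>n. ?D n)"
      by (rule finite_Lim_measure_decseq) (auto simp: decseq_def)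
    also have "(\<Inter>n. ?D n) = {}" by auto
    finally have "eventually (\<lambda>n. measure M (?D n) < e / 2) sequentially"
      using Union.prems by (intro order_tendstoD) auto
    then obtain n where n: "measure M (?D n) < e / 2" by (auto simp: eventually_sequentially)
    have "measure M ((\<Union>i. U i) - (\<Union>i\<in>{..n}. C i)) \<le> measure M (((\<Union>i. U i) - (\<Union>i. C i)) \<union> ?D n)"
      by (intro finite_measure_mono) auto
    also have "\<dots> \<le> measure M ((\<Union>i. U i) - (\<Union>i. C i)) + measure M (?D n)"
      by (intro measure_Un_le) auto
    also have "\<dots> < e" using 1 n by simp
    finally have "measure M ((\<Union>i. U i) - (\<Union>i\<in>{..n}. C i)) < e" .
    moreover have "closed (\<Union>i\<in>{..n}. C i)" "open (\<Union>i. U i)" using CU by (auto intro!: closed_UN)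
    moreover have "(\<Union>i\<in>{..n}. C i) \<subseteq> (\<Union>i. A i)" "(\<Union>i. A i) \<subseteq> (\<Union>i. U i)"
      using CU(3,4) by blast+
    ultimately show ?case
      by (intro exI[of _ "\<Union>i\<in>{..n}. C i"] exI[of _ "\<Union>i. U i"] conjI)
  qed
qed

lemma compact_dist_pos:
  fixes A B :: "'a::metric_space set"
  assumes "compact A" "compact B" "A \<inter> B = {}"
  shows "\<exists>d>0. \<forall>x\<in>A. \<forall>y\<in>B. d \<le> dist x y"
proof (cases "A \<times> B = {}")
  case True
  then show ?thesis by (intro exI[of _ 1]) auto
next
  case False
  have "\<exists>z\<in>A \<times> B. \<forall>w\<in>A \<times> B. dist (fst z) (snd z) \<le> dist (fst w) (snd w)"
    using assms False by (intro continuous_attains_inf compact_Times continuous_intros)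
  then obtain a b where "a \<in> A" "b \<in> B" "\<And>x y. x \<in> A \<Longrightarrow> y \<in> B \<Longrightarrow> dist a b \<le> dist x y" by force
  moreover from this have "dist a b > 0" using assms(3) by auto
  ultimately show ?thesis by blast
qed

text \<open>The \<open>Y\<close>-fibres contain compact sets of almost full measure; \<open>S\<close> reads off which of these
  sets is near, and \<open>W\<close> is the complement of their union.\<close>

lemma robust_code:
  fixes M :: "'a::metric_space measure" and Y :: "'a \<Rightarrow> nat"
  assumes "prob_space M" and X: "compact X" and sets: "sets M = sets (restrict_space borel X)"
    and Y[measurable]: "Y \<in> measurable M (count_space UNIV)" "\<And>x. x \<in> space M \<Longrightarrow> Y x < m" and \<tau>: "\<tau> > 0"
  obtains \<rho> S W where "\<rho> > 0" "S \<in> measurable M (count_space UNIV)" "W \<in> sets M"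
    "\<And>x. x \<in> space M \<Longrightarrow> S x < m" "\<And>x. x \<in> space M \<Longrightarrow> x \<notin> W \<Longrightarrow> S x = Y x" "measure M W < \<tau>"
    "\<And>x y. x \<in> space M \<Longrightarrow> y \<in> space M \<Longrightarrow> x \<notin> W \<Longrightarrow> dist x y < \<rho> \<Longrightarrow> S x = S y"
proof -
  interpret prob_space M by fact
  have space: "space M = X" using sets_eq_imp_space_eq[OF sets] by (simp add: space_restrict_space)
  have Int_sets: "A \<inter> X \<in> sets M" if "A \<in> sets borel" for A
    unfolding sets sets_restrict_space using that by (intro image_eqI[of _ _ A]) auto
  have m: "m > 0" using not_empty Y(2) by fastforce
  have id[measurable]: "(\<lambda>x. x) \<in> measurable M borel"
    unfolding measurable_cong_sets[OF sets refl] by (rule measurable_restrict_space1) simp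
  \<comment> \<open>The image measure lives on the Borel sets of the whole type, as
    \<open>borel_closed_open_approx\<close> requires.\<close>
  define N where "N = distr M borel (\<lambda>x. x)"
  interpret N: finite_measure N unfolding N_def by (rule finite_measure_distr) measurable
  have N: "measure N A = measure M (A \<inter> X)" if "A \<in> sets borel" for A
    using that unfolding N_def by (subst measure_distr) (auto simp: space)
  have "\<exists>C. closed C \<and> C \<inter> X \<subseteq> {x \<in> X. Y x = a} \<and> measure M ({x \<in> X. Y x = a} - C) < \<tau> / real m" for a
  proof -
    have "{x \<in> space M. Y x = a} \<in> sets M" by measurable
    then obtain B where B: "B \<in> sets borel" "{x \<in> X. Y x = a} = X \<inter> B"
      unfolding sets space by (auto simp: sets_restrict_space)
    obtain C U where CU: "closed C" "open U" "C \<subseteq> B" "B \<subseteq> U" "measure N (U - C) < \<tau> / real m"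
      using borel_closed_open_approx[OF N.finite_measure_axioms _ B(1), of "\<tau> / real m"] \<tau> m by (auto simp: N_def)
    have [measurable]: "(U - C) \<inter> X \<in> sets M"
      using CU by (intro Int_sets sets.Diff borel_open borel_closed)
    have "measure M ({x \<in> X. Y x = a} - C) \<le> measure M ((U - C) \<inter> X)"
      by (intro finite_measure_mono) (use B CU in auto)
    also have "\<dots> < \<tau> / real m" using CU N[of "U - C"] by simp
    finally have "measure M ({x \<in> X. Y x = a} - C) < \<tau> / real m" .
    moreover have "C \<inter> X \<subseteq> {x \<in> X. Y x = a}" unfolding B(2) using CU(3) by blast
    ultimately show ?thesis using CU(1) by blast
  qed
  then have "\<forall>a. \<exists>C. closed C \<and> C \<inter> X \<subseteq> {x \<in> X. Y x = a} \<and> measure M ({x \<in> X. Y x = a} - C) < \<tau> / real m" ..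
  from choice[OF this] obtain C where "\<forall>a. closed (C a) \<and> C a \<inter> X \<subseteq> {x \<in> X. Y x = a} \<and>
    measure M ({x \<in> X. Y x = a} - C a) < \<tau> / real m" ..
  then have C: "\<And>a. closed (C a)" "\<And>a. C a \<inter> X \<subseteq> {x \<in> X. Y x = a}"
    "\<And>a. measure M ({x \<in> X. Y x = a} - C a) < \<tau> / real m" by simp_all
  define K where "K a = C a \<inter> X" for a
  have K: "compact (K a)" "\<And>x. x \<in> K a \<Longrightarrow> x \<in> X \<and> Y x = a" for a
    unfolding K_def using C X by (auto simp: closed_Int_compact Int_commute)
  have K_sets[measurable]: "K a \<in> sets M" for a
    unfolding K_def using C by (intro Int_sets borel_closed)
  have "\<exists>d>0. \<forall>x\<in>K a. \<forall>y\<in>K b. d \<le> dist x y" if "a \<noteq> b" for a b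
    by (intro compact_dist_pos K(1)) (use K(2) that in blast)
  then have "\<forall>p. \<exists>d. fst p \<noteq> snd p \<longrightarrow> d > 0 \<and> (\<forall>x\<in>K (fst p). \<forall>y\<in>K (snd p). d \<le> dist x y)" by blast
  from choice[OF this] obtain d' where
    d': "\<forall>p. fst p \<noteq> snd p \<longrightarrow> d' p > 0 \<and> (\<forall>x\<in>K (fst p). \<forall>y\<in>K (snd p). d' p \<le> dist x y)" ..
  define d where "d a b = d' (a, b)" for a b
  have d: "d a b > 0" "\<And>x y. x \<in> K a \<Longrightarrow> y \<in> K b \<Longrightarrow> d a b \<le> dist x y" if "a \<noteq> b" for a b
  proof -
    have *: "d' (a, b) > 0 \<and> (\<forall>x\<in>K a. \<forall>y\<in>K b. d' (a, b) \<le> dist x y)"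
      by (rule mp[OF spec[OF d', of "(a, b)", unfolded fst_conv snd_conv] that])
    show "d a b > 0" using * unfolding d_def by (rule conjunct1)
    show "d a b \<le> dist x y" if "x \<in> K a" "y \<in> K b" for x y
      using bspec[OF bspec[OF conjunct2[OF *] that(1)] that(2)] unfolding d_def .
  qed
  define D where "D = insert 1 ((\<lambda>(a, b). d a b) ` {(a, b). a < m \<and> b < m \<and> a \<noteq> b})"
  have "finite {(a, b). a < m \<and> b < m \<and> a \<noteq> b}"
    by (rule finite_subset[of _ "{..<m} \<times> {..<m}"]) auto
  then have "finite D" by (simp add: D_def)
  \<comment> \<open>Half the least distance keeps the \<rho>-neighbourhoods of different
    \<open>K a\<close> disjoint. The element 1 of \<open>D\<close> provides a minimum when there is
    only one symbol.\<close>
  define \<rho> where "\<rho> = Min D / 2"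
  have \<rho>: "\<rho> > 0" unfolding \<rho>_def using \<open>finite D\<close> d(1) by (auto simp: D_def)
  have \<rho>_le: "2 * \<rho> \<le> dist x y" if "a < m" "b < m" "a \<noteq> b" "x \<in> K a" "y \<in> K b" for a b x y
  proof -
    have "Min D \<le> d a b" using \<open>finite D\<close> that by (intro Min_le) (auto simp: D_def)
    then show ?thesis using d(2)[OF that(3-5)] by (simp add: \<rho>_def)
  qed
  define P where "P a y \<longleftrightarrow> a < m \<and> (\<exists>x\<in>K a. dist x y < \<rho>)" for a y
  have P_meas[measurable]: "Measurable.pred M (P a)" for a
  proof -
    have "{y \<in> space M. P a y} = (if a < m then (\<Union>x\<in>K a. ball x \<rho>) \<inter> X else {})"
      by (auto simp: P_def space)
    also have "\<dots> \<in> sets M" using Int_sets[of "\<Union>x\<in>K a. ball x \<rho>"] by (simp add: borel_open open_UN)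
    finally show ?thesis by (simp add: pred_def)
  qed
  have P_unique: "a = b" if P_ab: "P a y" "P b y" for a b y
  proof (rule ccontr)
    assume "a \<noteq> b"
    obtain x x' where "x \<in> K a" "dist x y < \<rho>" "x' \<in> K b" "dist x' y < \<rho>" "a < m" "b < m"
      using P_ab by (auto simp: P_def)
    then show False using \<rho>_le[of a b x x'] \<open>a \<noteq> b\<close> dist_triangle2[of x x' y] by simp
  qed
  \<comment> \<open>By \<open>P_unique\<close> the least index is the only one. The default 0 merely
    has to be a valid symbol, which \<open>m > 0\<close> ensures.\<close>
  define S where "S y = (if \<exists>a. P a y then LEAST a. P a y else 0)" for y
  have S_eq: "S y = a" if "P a y" for a y
  proof -
    have "(LEAST a. P a y) = a" using LeastI[of "\<lambda>a. P a y", OF that] P_unique that by blast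
    then show ?thesis using that by (auto simp: S_def)
  qed
  have [measurable]: "S \<in> measurable M (count_space UNIV)" unfolding S_def by measurable
  define W where "W = space M - (\<Union>a<m. K a)"
  have W_near: "P (Y x) y" if x: "x \<in> space M" "x \<notin> W" "dist x y < \<rho>" for x y
  proof -
    obtain a where "a < m" "x \<in> K a" using x by (auto simp: W_def)
    then show ?thesis using K(2)[of x a] x by (auto simp: P_def)
  qed
  show thesis
  proof (rule that)
    show "\<rho> > 0" by fact
    show "W \<in> sets M" unfolding W_def by measurable
    show "S x < m" if "x \<in> space M" for x
    proof (cases "\<exists>a. P a x")
      case True
      then obtain a where "P a x" by blast
      then show ?thesis using S_eq[of a x] by (simp add: P_def)
    qed (use m in \<open>simp add: S_def\<close>)
    show "S x = Y x" if "x \<in> space M" "x \<notin> W" for x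
      using S_eq[OF W_near[OF that, of x]] \<rho> by simp
    show "S x = S y" if "x \<in> space M" "y \<in> space M" "x \<notin> W" "dist x y < \<rho>" for x y
      using S_eq[OF W_near[OF that(1,3,4)]] S_eq[OF W_near[OF that(1,3), of x]] \<rho> by simp
    have "measure M W \<le> measure M (\<Union>a<m. {x \<in> space M. Y x = a} - K a)"
      by (intro finite_measure_mono) (auto simp: W_def Y(2))
    also have "\<dots> \<le> (\<Sum>a<m. measure M ({x \<in> space M. Y x = a} - K a))"
      by (intro finite_measure_subadditive_finite) auto
    also have "\<dots> < (\<Sum>a<m. \<tau> / real m)"
    proof (intro sum_strict_mono)
      fix a
      have "{x \<in> space M. Y x = a} - K a = {x \<in> X. Y x = a} - C a" by (auto simp: K_def space)
      then show "measure M ({x \<in> space M. Y x = a} - K a) < \<tau> / real m" using C(3)[of a] by simp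
    qed (use m in auto)
    also have "\<dots> = \<tau>" using m by simp
    finally show "measure M W < \<tau>" .
  qed measurable
qed

text \<open>Total boundedness gives a finite cover by balls of radius \<open>\<delta> / 2\<close>. A
  point is labelled by the first ball that contains it, so equal labels force distance less than
  \<delta>.\<close>

lemma fine_code:
  fixes M :: "'a::metric_space measure"
  assumes "prob_space M" and X: "compact X" and sets: "sets M = sets (restrict_space borel X)" and \<delta>: "\<delta> > 0"
  obtains Y :: "'a \<Rightarrow> nat" and m where "Y \<in> measurable M (count_space UNIV)"
    "\<And>x. x \<in> space M \<Longrightarrow> Y x < m" "\<And>x y. x \<in> space M \<Longrightarrow> y \<in> space M \<Longrightarrow> Y x = Y y \<Longrightarrow> dist x y < \<delta>"
proof -
  interpret prob_space M by fact
  have space: "space M = X" using sets_eq_imp_space_eq[OF sets] by (simp add: space_restrict_space)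
  have Int_sets: "A \<inter> X \<in> sets M" if "A \<in> sets borel" for A
    unfolding sets sets_restrict_space using that by (intro image_eqI[of _ _ A]) auto
  obtain k where k: "finite k" "X \<subseteq> (\<Union>x\<in>k. ball x (\<delta> / 2))"
    using X \<delta> unfolding compact_eq_totally_bounded by (meson half_gt_zero)
  obtain l where l: "set l = k" using finite_list[OF k(1)] by blast
  define P where "P i y \<longleftrightarrow> i < length l \<and> dist (l ! i) y < \<delta> / 2" for i y
  have P_meas[measurable]: "Measurable.pred M (P i)" for i
  proof -
    have "{y \<in> space M. P i y} = (if i < length l then ball (l ! i) (\<delta> / 2) \<inter> X else {})"
      by (auto simp: P_def space)
    also have "\<dots> \<in> sets M" using Int_sets[of "ball (l ! i) (\<delta> / 2)"] by simp
    finally show ?thesis by (simp add: pred_def)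
  qed
  have P: "P (LEAST i. P i y) y" if "y \<in> space M" for y
  proof -
    have "y \<in> (\<Union>x\<in>set l. ball x (\<delta> / 2))" using k(2) that space l by blast
    then obtain x where x: "x \<in> set l" "dist x y < \<delta> / 2" by auto
    then obtain i where "i < length l" "l ! i = x" by (auto simp: in_set_conv_nth)
    then have "P i y" using x by (simp add: P_def)
    then show ?thesis by (rule LeastI)
  qed
  show thesis
  proof (rule that)
    show "(\<lambda>y. LEAST i. P i y) \<in> measurable M (count_space UNIV)" by measurable
    show "(LEAST i. P i x) < length l" if "x \<in> space M" for x using P[OF that] by (simp add: P_def)
    show "dist x y < \<delta>" if "x \<in> space M" "y \<in> space M" "(LEAST i. P i x) = (LEAST i. P i y)" for x y
      using P[OF that(1)] P[OF that(2)] that(3) dist_triangle_half_r[of "l ! (LEAST i. P i y)" x \<delta> y]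
      by (simp add: P_def)
  qed
qed

section \<open>Return rates\<close>

lemma return_time_attained:
  assumes "return_time X f g n x \<epsilon> = enat k"
  shows "1 \<le> k \<and> (f ^^ k) x \<in> mistake_ball X f g n x \<epsilon>"
proof -
  let ?S = "enat ` {k. 1 \<le> k \<and> (f ^^ k) x \<in> mistake_ball X f g n x \<epsilon>}"
  have "?S \<noteq> {}"
  proof
    assume empty: "?S = {}"
    have "return_time X f g n x \<epsilon> = \<infinity>" unfolding return_time_def empty by (simp add: Inf_enat_def)
    with assms show False by simp
  qed
  then have "Inf ?S \<in> ?S" unfolding Inf_enat_def by (auto intro: LeastI)
  then show ?thesis using assms by (auto simp: return_time_def)
qed

lemma return_rate_nonneg: "0 \<le> return_rate X f g n x \<epsilon>"
proof -
  have "0 \<le> ln_enat r" for r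
  proof (cases r)
    case (enat k)
    then show ?thesis by (cases "k = 0") (auto simp: ln_enat_def)
  qed (simp add: ln_enat_def)
  then show ?thesis unfolding return_rate_def by (intro ereal_0_le_mult) auto
qed

lemma dyn_dist_less_iff:
  assumes "\<epsilon> > 0" "finite \<Lambda>"
  shows "dyn_dist f \<Lambda> x y < \<epsilon> \<longleftrightarrow> (\<forall>i\<in>\<Lambda>. dist ((f ^^ i) x) ((f ^^ i) y) < \<epsilon>)"
  using assms by (simp add: dyn_dist_def)

lemma return_rate_ge:
  assumes n: "n \<ge> 1"
    and far: "\<And>k. 1 \<le> k \<Longrightarrow> (f ^^ k) x \<in> mistake_ball X f g n x \<epsilon> \<Longrightarrow> exp (c * real n) \<le> real k"
  shows "ereal c \<le> return_rate X f g n x \<epsilon>"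
proof (cases "return_time X f g n x \<epsilon>")
  case (enat k)
  then have k: "1 \<le> k" "exp (c * real n) \<le> real k" using far return_time_attained by blast+
  then have "c * real n \<le> ln (real k)" by (subst ln_ge_iff) auto
  then have "c \<le> 1 / real n * ln (real k)" using n by (simp add: field_simps)
  then show ?thesis by (simp add: return_rate_def enat ln_enat_def)
next
  case infinity
  then show ?thesis using n by (simp add: return_rate_def ln_enat_def)
qed

lemma return_rate_le:
  assumes n: "n \<ge> 1" and k: "1 \<le> k" "(f ^^ k) x \<in> mistake_ball X f g n x \<epsilon>" "real k \<le> exp (c * real n)"
  shows "return_rate X f g n x \<epsilon> \<le> ereal c"
proof -
  have "return_time X f g n x \<epsilon> \<le> enat k"
    unfolding return_time_def using k by (intro Inf_lower) auto
  then obtain j where j: "return_time X f g n x \<epsilon> = enat j" "j \<le> k"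
    by (cases "return_time X f g n x \<epsilon>") auto
  then have "1 \<le> j" using return_time_attained by blast
  then have "ln (real j) \<le> ln (exp (c * real n))" using j k by (subst ln_le_cancel_iff) auto
  then have "1 / real n * ln (real j) \<le> c" using n by (simp add: field_simps)
  then show ?thesis by (simp add: return_rate_def j ln_enat_def)
qed

section \<open>From mistake balls to symbol mismatches and back\<close>

locale metric_mpt = mpt M T for M :: "'a::metric_space measure" and T
begin

text \<open>At a mismatch outside \<open>W\<close> the two orbits are at least \<epsilon> apart, so
  its time is not in \<Lambda>, and \<Lambda> misses at most \<open>g n \<epsilon>\<close>
  times.\<close>

lemma mismatches_le_mistakes:
  assumes \<epsilon>: "\<epsilon> > 0" and x: "x \<in> space M" and ball: "(T ^^ k) x \<in> mistake_ball X T g n x \<epsilon>"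
    and S: "\<And>x y. x \<in> space M \<Longrightarrow> y \<in> space M \<Longrightarrow> x \<notin> W \<Longrightarrow> dist x y < \<epsilon> \<Longrightarrow> S x = S y"
  shows "mismatches S W n k x \<le> g n \<epsilon>"
proof -
  obtain \<Lambda> where \<Lambda>: "\<Lambda> \<subseteq> {0..<n}" "card \<Lambda> \<ge> n - g n \<epsilon>" and "dyn_dist T \<Lambda> x ((T ^^ k) x) < \<epsilon>"
    using ball by (auto simp: mistake_ball_def mistake_index_sets_def dyn_ball_def)
  moreover have fin: "finite \<Lambda>" using \<Lambda>(1) finite_subset by blast
  ultimately have close: "dist ((T ^^ i) x) ((T ^^ (i + k)) x) < \<epsilon>" if "i \<in> \<Lambda>" for i
    using that \<epsilon> by (auto simp: dyn_dist_less_iff funpow_add)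
  have "S ((T ^^ i) x) = S ((T ^^ (i + k)) x)" if "i \<in> \<Lambda>" "(T ^^ i) x \<notin> W" for i
    using S[OF _ _ that(2) close[OF that(1)]] funpow_space[OF x] by simp
  then have "{i. i < n \<and> S ((T ^^ i) x) \<noteq> S ((T ^^ (i + k)) x) \<and> (T ^^ i) x \<notin> W} \<subseteq> {0..<n} - \<Lambda>" by auto
  then have "mismatches S W n k x \<le> card ({0..<n} - \<Lambda>)" unfolding mismatches_def by (intro card_mono) auto
  also have "\<dots> = n - card \<Lambda>" using \<Lambda>(1) fin by (simp add: card_Diff_subset)
  also have "\<dots> \<le> g n \<epsilon>" using \<Lambda>(2) by simp
  finally show ?thesis .
qed

text \<open>Sublinearity of the mistakes enters here. Failure of recurrence fixes a \<open>p\<close>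
  such that early repetitions have more than \<open>n / (p + 1)\<close> mismatches for large
  \<open>n\<close>; a return to the mistake ball eventually has fewer, so it cannot be
  early.\<close>

lemma liminf_return_rate_ge:
  assumes c: "\<not> recurrent S W c x" and \<epsilon>: "\<epsilon> > 0" and x: "x \<in> space M"
    and S: "\<And>x y. x \<in> space M \<Longrightarrow> y \<in> space M \<Longrightarrow> x \<notin> W \<Longrightarrow> dist x y < \<epsilon> \<Longrightarrow> S x = S y"
    and g: "(\<lambda>n. real (g n \<epsilon>) / real n) \<longlonglongrightarrow> 0"
  shows "ereal c \<le> liminf (\<lambda>n. return_rate X T g n x \<epsilon>)"
proof -
  obtain p N :: nat where pN: "\<And>n k. N \<le> n \<Longrightarrow> 1 \<le> k \<Longrightarrow> real k \<le> exp ((c + 1 / real (Suc p)) * real n) \<Longrightarrow>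
      1 / real (Suc p) * real n < real (mismatches S W n k x)"
    using c unfolding recurrent_def by (meson not_le)
  have "eventually (\<lambda>n. real (g n \<epsilon>) / real n < 1 / real (Suc p)) sequentially"
    using g by (rule order_tendstoD) simp
  then have "eventually (\<lambda>n. ereal c \<le> return_rate X T g n x \<epsilon>) sequentially"
    using eventually_ge_at_top[of "max N 1"]
  proof eventually_elim
    case (elim n)
    show ?case
    proof (rule return_rate_ge)
      show "n \<ge> 1" using elim by simp
      fix k assume k: "1 \<le> k" "(T ^^ k) x \<in> mistake_ball X T g n x \<epsilon>"
      have "real (mismatches S W n k x) \<le> real (g n \<epsilon>)"
        using mismatches_le_mistakes[OF \<epsilon> x k(2) S] by simp
      also have "\<dots> \<le> 1 / real (Suc p) * real n" using elim by (simp add: field_simps)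
      finally have "exp ((c + 1 / real (Suc p)) * real n) < real k" using pN[of n k] k elim by force
      moreover have "exp (c * real n) \<le> exp ((c + 1 / real (Suc p)) * real n)"
        by (simp add: mult_right_mono)
      ultimately show "exp (c * real n) \<le> real k" by linarith
    qed
  qed
  then show ?thesis by (rule Liminf_bounded)
qed

text \<open>Repeating the word keeps the orbits \<epsilon>-close at all \<open>n\<close> times, so
  this is a return with the full index set, which is admissible for every \<open>g\<close>.\<close>

lemma limsup_return_rate_le:
  assumes x: "x \<in> space M" and \<epsilon>: "\<epsilon> > 0" and X: "space M = X"
    and ret: "eventually (\<lambda>n. \<exists>k\<ge>1. real k \<le> exp (c * real n) \<and> word Y n ((T ^^ k) x) = word Y n x) sequentially"
    and Y: "\<And>x y. x \<in> space M \<Longrightarrow> y \<in> space M \<Longrightarrow> Y x = Y y \<Longrightarrow> dist x y < \<epsilon>"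
  shows "limsup (\<lambda>n. return_rate X T g n x \<epsilon>) \<le> ereal c"
proof (rule Limsup_bounded)
  show "eventually (\<lambda>n. return_rate X T g n x \<epsilon> \<le> ereal c) sequentially"
    using ret eventually_ge_at_top[of 1]
  proof eventually_elim
    case (elim n)
    then obtain k where k: "k \<ge> 1" "real k \<le> exp (c * real n)" "word Y n ((T ^^ k) x) = word Y n x" by blast
    have kx: "(T ^^ k) x \<in> space M" using funpow_space[OF x] .
    have "dist ((T ^^ i) x) ((T ^^ i) ((T ^^ k) x)) < \<epsilon>" if "i < n" for i
    proof (rule Y)
      have "word Y n ((T ^^ k) x) ! i = word Y n x ! i" using k(3) by simp
      then show "Y ((T ^^ i) x) = Y ((T ^^ i) ((T ^^ k) x))" using that by simp
    qed (intro funpow_space x kx)+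
    then have "(T ^^ k) x \<in> dyn_ball X T {0..<n} x \<epsilon>"
      using kx \<epsilon> by (simp add: dyn_ball_def dyn_dist_less_iff X)
    moreover have "{0..<n} \<in> mistake_index_sets g n \<epsilon>" by (simp add: mistake_index_sets_def)
    ultimately have "(T ^^ k) x \<in> mistake_ball X T g n x \<epsilon>" unfolding mistake_ball_def by blast
    then show ?case using elim k by (intro return_rate_le[of n k]) auto
  qed
qed

end

lemma mistake_extension_sublinear:
  assumes "mistake_function \<epsilon>0 g" "\<epsilon> > 0"
  shows "(\<lambda>n. real (mistake_extension \<epsilon>0 g n \<epsilon>) / real n) \<longlonglongrightarrow> 0"
proof (cases "\<epsilon> \<le> \<epsilon>0")
  case True
  then have "(\<lambda>n. real (g n \<epsilon>) / real n) \<longlonglongrightarrow> 0" using assms by (simp add: mistake_function_def)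
  then show ?thesis using True by (simp add: mistake_extension_def)
next
  case False
  have "(\<lambda>n. real (g n \<epsilon>0) / real n) \<longlonglongrightarrow> 0" using assms(1) by (simp add: mistake_function_def)
  then show ?thesis using False by (simp add: mistake_extension_def)
qed

theorem theoremA:
  fixes X :: "'a::metric_space set"
    and f :: "'a \<Rightarrow> 'a"
    and \<epsilon>0 :: real
    and g :: "nat \<Rightarrow> real \<Rightarrow> nat"
    and \<mu> :: "'a measure"
  assumes "compact X"
    and "continuous_on X f"
    and "f ` X \<subseteq> X"
    and "mistake_function \<epsilon>0 g"
    and "sets \<mu> = sets (restrict_space borel X)"
    and "prob_space \<mu>"
    and "ergodic_measure f \<mu>"
  shows "AE x in \<mu>.
      ((\<lambda>\<epsilon>. limsup (\<lambda>n. return_rate X f (mistake_extension \<epsilon>0 g) n x \<epsilon>))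
          \<longlongrightarrow> measure_entropy \<mu> f) (at_right 0) \<and>
      ((\<lambda>\<epsilon>. liminf (\<lambda>n. return_rate X f (mistake_extension \<epsilon>0 g) n x \<epsilon>))
          \<longlongrightarrow> measure_entropy \<mu> f) (at_right 0)"
proof -
  interpret prob_space \<mu> by fact
  interpret ergodic_mpt \<mu> f
    by unfold_locales (use assms(7) in \<open>auto simp: ergodic_measure_def invariant_measure_def\<close>)
  interpret metric_mpt \<mu> f ..
  have space: "space \<mu> = X"
    using sets_eq_imp_space_eq[OF assms(5)] by (simp add: space_restrict_space)
  let ?h = "measure_entropy \<mu> f" and ?G = "mistake_extension \<epsilon>0 g"
  let ?r = "\<lambda>x \<epsilon> n. return_rate X f ?G n x \<epsilon>"
  have lower: "AE x in \<mu>. ereal (of_rat r) < ?h \<longrightarrow>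
      (\<exists>\<rho>>0. \<forall>\<epsilon>. 0 < \<epsilon> \<longrightarrow> \<epsilon> < \<rho> \<longrightarrow> ereal (of_rat r) \<le> liminf (?r x \<epsilon>))" for r
  \<comment> \<open>\<open>AE_not_recurrent\<close> asks for a nonnegative rate; negative thresholds
    are trivial because return rates are nonnegative.\<close>
  proof (cases "ereal (of_rat r) < ?h \<and> r \<ge> 0")
    case True
    then obtain \<xi> where \<xi>: "finite_measurable_partition \<mu> \<xi>" "of_rat r < entropy_wrt_partition \<mu> f \<xi>"
      unfolding measure_entropy_def by (auto simp: less_SUP_iff)
    obtain Y :: "'a \<Rightarrow> nat" and m where Y: "Y \<in> measurable \<mu> (count_space UNIV)"
      "\<And>x. x \<in> space \<mu> \<Longrightarrow> Y x < m" "fibres \<mu> Y = \<xi>"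
      using finite_measurable_partition_code[OF \<xi>(1)] by blast
    interpret ergodic_coded_mpt \<mu> f Y m by unfold_locales (use Y in auto)
    have "0 \<le> real_of_rat r" "real_of_rat r < rate"
      using True \<xi>(2) entropy_wrt_fibres by (simp_all add: Y(3))
    then obtain \<tau> where \<tau>: "\<tau> > 0" "\<And>S W. S \<in> measurable \<mu> (count_space UNIV) \<Longrightarrow> W \<in> sets \<mu> \<Longrightarrow>
        (\<And>x. x \<in> space \<mu> \<Longrightarrow> S x < m) \<Longrightarrow> (\<And>x. x \<in> space \<mu> \<Longrightarrow> x \<notin> W \<Longrightarrow> S x = Y x) \<Longrightarrow>
        measure \<mu> W < \<tau> \<Longrightarrow> AE x in \<mu>. \<not> recurrent S W (of_rat r) x"
      using AE_not_recurrent by blast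
    obtain \<rho> S W where \<rho>: "\<rho> > 0" and SW: "S \<in> measurable \<mu> (count_space UNIV)" "W \<in> sets \<mu>"
      "\<And>x. x \<in> space \<mu> \<Longrightarrow> S x < m" "\<And>x. x \<in> space \<mu> \<Longrightarrow> x \<notin> W \<Longrightarrow> S x = Y x" "measure \<mu> W < \<tau>"
      and sep: "\<And>x y. x \<in> space \<mu> \<Longrightarrow> y \<in> space \<mu> \<Longrightarrow> x \<notin> W \<Longrightarrow> dist x y < \<rho> \<Longrightarrow> S x = S y"
      using robust_code[OF assms(6,1,5) Y(1,2) \<tau>(1)] by blast
    have "AE x in \<mu>. \<not> recurrent S W (of_rat r) x" by (rule \<tau>(2)) (fact SW)+
    then show ?thesis using AE_space
    proof eventually_elim
      case (elim x)
      have "ereal (of_rat r) \<le> liminf (?r x \<epsilon>)" if "0 < \<epsilon>" "\<epsilon> < \<rho>" for \<epsilon>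
      proof (rule liminf_return_rate_ge[OF elim(1) that(1) elim(2)])
        show "S y = S z" if "y \<in> space \<mu>" "z \<in> space \<mu>" "y \<notin> W" "dist y z < \<epsilon>" for y z
          using sep[of y z] that \<open>\<epsilon> < \<rho>\<close> by simp
      qed (rule mistake_extension_sublinear[OF assms(4) that(1)])
      then show ?case using \<rho> by blast
    qed
  next
    case False
    have "0 \<le> liminf (?r x \<epsilon>)" for x \<epsilon>
      by (intro Liminf_bounded always_eventually allI return_rate_nonneg)
    then have "ereal (of_rat r) \<le> liminf (?r x \<epsilon>)" if "r < 0" for x \<epsilon>
      using that order_trans[of "ereal (of_rat r)" 0] by simp
    then show ?thesis using False by (intro AE_I2 impI exI[of _ 1]) auto
  qed
  have upper: "AE x in \<mu>. ?h < ereal (of_rat r) \<longrightarrow>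
      (\<forall>\<epsilon>\<ge>1 / real (Suc q). limsup (?r x \<epsilon>) \<le> ereal (of_rat r))" for r q
  proof (cases "?h < ereal (of_rat r)")
    case True
    obtain Y :: "'a \<Rightarrow> nat" and m where Y: "Y \<in> measurable \<mu> (count_space UNIV)"
      "\<And>x. x \<in> space \<mu> \<Longrightarrow> Y x < m"
      and small: "\<And>x y. x \<in> space \<mu> \<Longrightarrow> y \<in> space \<mu> \<Longrightarrow> Y x = Y y \<Longrightarrow> dist x y < 1 / real (Suc q)"
      using fine_code[OF assms(6,1,5), of "1 / real (Suc q)"] by (auto simp del: of_nat_Suc)
    interpret ergodic_coded_mpt \<mu> f Y m by unfold_locales (use Y in auto)
    have "ereal rate < ereal (of_rat r)" using rate_le_measure_entropy True by (rule le_less_trans)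
    then have "rate < of_rat r" by simp
    from cylinder_return_time[OF this] AE_space show ?thesis
    proof eventually_elim
      case (elim x)
      have "limsup (?r x \<epsilon>) \<le> ereal (of_rat r)" if "\<epsilon> \<ge> 1 / real (Suc q)" for \<epsilon>
      proof (rule limsup_return_rate_le[OF _ _ space elim(1)])
        show "\<epsilon> > 0" by (rule less_le_trans[OF _ that]) simp
        show "dist x y < \<epsilon>" if "x \<in> space \<mu>" "y \<in> space \<mu>" "Y x = Y y" for x y
          using small[OF that] \<open>\<epsilon> \<ge> 1 / real (Suc q)\<close> by linarith
      qed (use elim in auto)
      then show ?case by blast
    qed
  qed simp
  have "AE x in \<mu>. \<forall>r. ereal (of_rat r) < ?h \<longrightarrow>
      (\<exists>\<rho>>0. \<forall>\<epsilon>. 0 < \<epsilon> \<longrightarrow> \<epsilon> < \<rho> \<longrightarrow> ereal (of_rat r) \<le> liminf (?r x \<epsilon>))"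
    using lower by (simp add: AE_all_countable)
  moreover have "AE x in \<mu>. \<forall>r q. ?h < ereal (of_rat r) \<longrightarrow>
      (\<forall>\<epsilon>\<ge>1 / real (Suc q). limsup (?r x \<epsilon>) \<le> ereal (of_rat r))"
    using upper unfolding AE_all_countable by blast
  ultimately show ?thesis
  proof eventually_elim
    case (elim x)
    \<comment> \<open>The lower estimate is available for the liminf and the upper one for the
      limsup; this inequality supplies the two missing ones.\<close>
    have le: "liminf (?r x \<epsilon>) \<le> limsup (?r x \<epsilon>)" for \<epsilon> by (rule Liminf_le_Limsup) simp
    have lo: "eventually (\<lambda>\<epsilon>. a < liminf (?r x \<epsilon>)) (at_right 0)" if a: "a < ?h" for a
    proof -
      obtain r where r: "a < ereal (of_rat r)" "ereal (of_rat r) < ?h" using ereal_dense3[OF a] by blast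
      then obtain \<rho> where "\<rho> > 0" "\<And>\<epsilon>. 0 < \<epsilon> \<Longrightarrow> \<epsilon> < \<rho> \<Longrightarrow> ereal (of_rat r) \<le> liminf (?r x \<epsilon>)"
        using elim(1) by blast
      then show ?thesis using r(1) by (intro eventually_at_rightI[of 0 \<rho>]) (auto intro: less_le_trans)
    qed
    have hi: "eventually (\<lambda>\<epsilon>. limsup (?r x \<epsilon>) < a) (at_right 0)" if a: "?h < a" for a
    proof -
      obtain r where r: "?h < ereal (of_rat r)" "ereal (of_rat r) < a" using ereal_dense3[OF a] by blast
      have "limsup (?r x \<epsilon>) < a" if "\<epsilon> > 0" for \<epsilon>
      proof -
        obtain q where "1 / real (Suc q) < \<epsilon>" using \<open>\<epsilon> > 0\<close> by (rule nat_approx_posE)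
        then have "limsup (?r x \<epsilon>) \<le> ereal (of_rat r)" using elim(2) r(1) less_imp_le by blast
        then show ?thesis using r(2) by (rule le_less_trans)
      qed
      then show ?thesis by (intro eventually_at_rightI[of 0 1]) auto
    qed
    show ?case
    proof (intro conjI order_tendstoI)
      show "eventually (\<lambda>\<epsilon>. a < limsup (?r x \<epsilon>)) (at_right 0)" if "a < ?h" for a
        using lo[OF that] by eventually_elim (rule less_le_trans[OF _ le])
      show "eventually (\<lambda>\<epsilon>. liminf (?r x \<epsilon>) < a) (at_right 0)" if "?h < a" for a
        using hi[OF that] by eventually_elim (rule le_less_trans[OF le])
    qed (fact lo hi)+
  qed
qed

end
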